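(* Let $S$ be a finite set with a fixed total order $<$, let $R$ be a commutative ring with $1$ and $q\in R$. Let $\mathfrak M$ be the set of circuits of a loopless matroid without parallel elements on ground set $S$, and let $\overline{\mathfrak M}$ be the set of Gröbner circuits of $\mathfrak M$ (with respect to $<$). Then $I_q(\mathfrak M)=I_q(\overline{\mathfrak M})$, and the set $G_q(\overline{\mathfrak M})$ is a Gröbner basis of the ideal $I_q(\mathfrak M)$ with respect to the degree lexicographic order; this holds for every choice of $q\in R$.
   Context: $A=R\langle t_s\mid s\in S\rangle$ is the free associative (non-commutative polynomial) algebra over $R$. For $J\subseteq S$ write $J=\{j_1<\dots<j_{\#J}\}$ and $t_J=t_{j_1}\cdots t_{j_{\#J}}$ ($t_\emptyset=1$). For $I=\{j_{\alpha_1}<\dots<j_{\alpha_{\#I}}\}\subseteq J$ put $\ell_J(I)=\sum_{\nu=1}^{\#I}(\alpha_\nu-\nu)$, and $\tau^-_J=\sum_{I\subseteq J,\ \#I\text{ odd}}(-1)^{\ell_J(I)}(-q)^{(\#I-1)/2}t_{J\setminus I}$. For a set system $\mathfrak N\subseteq 2^S$, $G_q(\mathfrak N)\subseteq A$ consists of the elements $t_s^2-q$ ($s\in S$), $t_rt_s+t_st_r-2q$ ($r,s\in S$, $s<r$), and $\tau^-_J$ ($J\in\mathfrak N$); $I_q(\mathfrak N)$ is the two-sided ideal of $A$ generated by $G_q(\mathfrak N)$. The degree lexicographic (deglex) order on monomials (words) of $A$: $t_{i_1}\cdots t_{i_k}<t_{j_1}\cdots t_{j_l}$ iff $k<l$,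 or $k=l$ and for some $h$ one has $i_1=j_1,\dots,i_h=j_h$ and $i_{h+1}<j_{h+1}$. The leading term/monomial of a polynomial is its term/monomial with the deglex-largest monomial. A subset $G$ of a two-sided ideal $I$ is a Gröbner basis of $I$ if the two-sided ideal generated by the leading terms of elements of $G$ equals the two-sided ideal generated by the leading terms of all elements of $I$. Matroid terminology: a loopless matroid without parallel elements is given by its set of circuits $\mathfrak M\subseteq 2^S$ satisfying: every circuit has more than $2$ elements; no circuit properly contains another; for distinct circuits $J,K$ and $x\in J\cap K$ there is a circuit contained in $(J\cup K)\setminus\{x\}$. A set is dependent if it contains a circuit. Subsets of $S$ are ordered by deglex: $J<_{\rm dlex}K$ iff $\#J<\#K$, or $\#J=\#K$ and the minimum of the symmetric difference of $J$ and $K$ lies in $J$. $K$ is a convex subset of $J$, written $K\sqsubseteq J$, if $K\subseteq J$ and every $j\in J$ with $k<j<k'$ for some $k,k'\in K$ lies in $K$. The set $\overline{\mathfrak M}$ of Gröbner circuits is defined recursively along $<_{\rm dlex}$: a dependent set $J$ belongs to $\overline{\mathfrak M}$ iff for every $K\in\overline{\mathfrak M}$ with $K<_{\rm dlex}J$ one has $K\setminus\{k_1\}\not\sqsubseteq J\setminus\{j_1\}$. *)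

theory Defs
  imports "HOL-Library.Poly_Mapping"
begin

text \<open>Non-commutative polynomials over a ring R in letters of type 'a:
  finitely supported maps from words (lists of letters) to R.
  The free algebra A = R<t_s | s in S> consists of those whose words lie in S*.\<close>

type_synonym ('a, 'r) ncpoly = "'a list \<Rightarrow>\<^sub>0 'r"

definition ncmon :: "'r::zero \<Rightarrow> 'a list \<Rightarrow> ('a, 'r) ncpoly" where
  "ncmon c w = Poly_Mapping.single w c"

definition nmul :: "('a, 'r::comm_ring_1) ncpoly \<Rightarrow> ('a, 'r) ncpoly \<Rightarrow> ('a, 'r) ncpoly" where
  "nmul p p' = (\<Sum>u\<in>Poly_Mapping.keys p. \<Sum>v\<in>Poly_Mapping.keys p'. ncmon (Poly_Mapping.lookup p u * Poly_Mapping.lookup p' v) (u @ v))"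

inductive_set ideal_gen :: "'a set \<Rightarrow> ('a, 'r::comm_ring_1) ncpoly set \<Rightarrow> ('a, 'r) ncpoly set"
  for S G where
  zero: "0 \<in> ideal_gen S G"
| gen: "g \<in> G \<Longrightarrow> g \<in> ideal_gen S G"
| add: "p \<in> ideal_gen S G \<Longrightarrow> p' \<in> ideal_gen S G \<Longrightarrow> p + p' \<in> ideal_gen S G"
| mult: "p \<in> ideal_gen S G \<Longrightarrow> set u \<subseteq> S \<Longrightarrow> set v \<subseteq> S \<Longrightarrow>
     nmul (ncmon c u) (nmul p (ncmon 1 v)) \<in> ideal_gen S G"

definition deglex_less :: "'a::linorder list \<Rightarrow> 'a list \<Rightarrow> bool" where
  "deglex_less u v \<longleftrightarrow> length u < length v \<or>
     (length u = length v \<and> (\<exists>h < length u. take h u = take h v \<and> u ! h < v ! h))"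

definition lead_mon :: "('a::linorder, 'r::zero) ncpoly \<Rightarrow> 'a list" where
  "lead_mon p = (THE w. w \<in> Poly_Mapping.keys p \<and> (\<forall>v\<in>Poly_Mapping.keys p. v \<noteq> w \<longrightarrow> deglex_less v w))"

definition lead_term :: "('a::linorder, 'r::zero) ncpoly \<Rightarrow> ('a, 'r) ncpoly" where
  "lead_term p = (if p = 0 then 0 else ncmon (Poly_Mapping.lookup p (lead_mon p)) (lead_mon p))"

definition is_groebner_basis :: "'a::linorder set \<Rightarrow> ('a, 'r::comm_ring_1) ncpoly set \<Rightarrow> ('a, 'r) ncpoly set \<Rightarrow> bool" where
  "is_groebner_basis S G I \<longleftrightarrow> G \<subseteq> I \<and>
     ideal_gen S (lead_term ` G) = ideal_gen S (lead_term ` I)"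

definition tJ :: "'a::linorder set \<Rightarrow> ('a, 'r::comm_ring_1) ncpoly" where
  "tJ J = ncmon 1 (sorted_list_of_set J)"

text \<open>ell_J(I) = sum over nu of (alpha_nu - nu), where alpha_nu is the (1-based) position of the
  nu-th element of I inside J.\<close>
definition ellJ :: "'a::linorder set \<Rightarrow> 'a set \<Rightarrow> nat" where
  "ellJ J I = (\<Sum>i\<in>I. card {j\<in>J. j \<le> i} - card {i'\<in>I. i' \<le> i})"

definition tau_minus :: "'r::comm_ring_1 \<Rightarrow> 'a::linorder set \<Rightarrow> ('a, 'r) ncpoly" where
  "tau_minus q J = (\<Sum>I\<in>{I. I \<subseteq> J \<and> odd (card I)}.
       ncmon ((-1) ^ ellJ J I * (- q) ^ ((card I - 1) div 2)) (sorted_list_of_set (J - I)))"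

definition Gq :: "'a::linorder set \<Rightarrow> 'r::comm_ring_1 \<Rightarrow> 'a set set \<Rightarrow> ('a, 'r) ncpoly set" where
  "Gq S q N =
     {ncmon 1 [s, s] - ncmon q [] | s. s \<in> S}
   \<union> {ncmon 1 [r, s] + ncmon 1 [s, r] - ncmon (2 * q) [] | r s. r \<in> S \<and> s \<in> S \<and> s < r}
   \<union> {tau_minus q J | J. J \<in> N}"

definition Iq :: "'a::linorder set \<Rightarrow> 'r::comm_ring_1 \<Rightarrow> 'a set set \<Rightarrow> ('a, 'r) ncpoly set" where
  "Iq S q N = ideal_gen S (Gq S q N)"

definition matroid_circuits :: "'a set \<Rightarrow> 'a set set \<Rightarrow> bool" where
  "matroid_circuits S M \<longleftrightarrow> M \<subseteq> Pow S \<and>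
     (\<forall>C\<in>M. card C > 2) \<and>
     (\<forall>C\<in>M. \<forall>D\<in>M. \<not> C \<subset> D) \<and>
     (\<forall>J\<in>M. \<forall>K\<in>M. \<forall>x. J \<noteq> K \<and> x \<in> J \<inter> K \<longrightarrow> (\<exists>C\<in>M. C \<subseteq> (J \<union> K) - {x}))"

definition dependent_in :: "'a set set \<Rightarrow> 'a set \<Rightarrow> bool" where
  "dependent_in M J \<longleftrightarrow> (\<exists>C\<in>M. C \<subseteq> J)"

definition dlex_less :: "'a::linorder set \<Rightarrow> 'a set \<Rightarrow> bool" where
  "dlex_less J K \<longleftrightarrow> card J < card K \<or>
     (card J = card K \<and> J \<noteq> K \<and> Min ((J - K) \<union> (K - J)) \<in> J)"

definition convex_sub :: "'a::linorder set \<Rightarrow> 'a set \<Rightarrow> bool" where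
  "convex_sub K J \<longleftrightarrow> K \<subseteq> J \<and> (\<forall>j\<in>J. \<forall>k\<in>K. \<forall>k'\<in>K. k < j \<and> j < k' \<longrightarrow> j \<in> K)"

text \<open>Groebner circuits: the unique family of subsets of S satisfying the recursive
  characterisation along the (well-founded on finite sets) order dlex_less.\<close>
definition groebner_circuits :: "'a::linorder set \<Rightarrow> 'a set set \<Rightarrow> 'a set set" where
  "groebner_circuits S M = (THE X. X \<subseteq> Pow S \<and>
     (\<forall>J. J \<subseteq> S \<longrightarrow> (J \<in> X \<longleftrightarrow> dependent_in M J \<and>
        (\<forall>K\<in>X. dlex_less K J \<longrightarrow> \<not> convex_sub (K - {Min K}) (J - {Min J})))))"

end

theory Submission
  imports Defs
begin

text \<open>Modulo the quadratic relations the free algebra becomes the Clifford algebra of the form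
  \<open>q (\<Sum>\<^sub>s a\<^sub>s)\<^sup>2\<close>, in which the differences \<open>t\<^sub>r - t\<^sub>s\<close> anticommute and square to zero, and \<open>\<tau>\<^sup>-\<^sub>J\<close> becomes the
  product of the successive differences of \<open>J\<close>. Hence \<open>\<tau>\<^sup>-\<^sub>J\<close> lies in the ideal as soon as \<open>J\<close> contains a
  circuit. The leading words of the generators are the squares, the descents and, up to
  divisibility, the increasing words of sets that contain a broken circuit. It remains to
  exclude that some \<open>f\<close> in the ideal has as leading word the increasing word of a set \<open>K\<close> without
  broken circuits. The closures of the upper segments of \<open>K\<close> form a flag of flats; identifying letters
  that enter the flag at the same step maps the free algebra to a Clifford algebra with one
  generator per step. No circuit meets each step at most once, so the ideal is mapped to zero; but among
  the words up to that of \<open>K\<close> only the word of \<open>K\<close> itself has a component at the product of all steps,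
  because each element of \<open>K\<close> is the minimum of its step.\<close>

section \<open>The Clifford relations\<close>

text \<open>With concatenation as addition of words, the ring structure on \<^typ>\<open>'b \<Rightarrow>\<^sub>0 'r\<close> over a monoid of
  exponents specialises to the free algebra.\<close>

instantiation list :: (type) monoid_add
begin
definition "0 = []"
definition "u + v = u @ v"
instance
  by standard (auto simp: zero_list_def plus_list_def)
end

lemma ncmon_0 [simp]: "ncmon 0 w = 0"
  by (simp add: ncmon_def)

lemma ncmon_add: "ncmon (c + d) w = ncmon c w + ncmon d w"
  by (simp add: ncmon_def single_add)

lemma ncmon_double: "ncmon (2 * c) w = ncmon c w + ncmon c w"
  for c :: "'r::comm_ring_1"
  by (metis mult_2 ncmon_add)

lemma ncmon_uminus: "ncmon (- c) w = - ncmon c w"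
  for c :: "'r::comm_ring_1"
  by (simp add: ncmon_def single_uminus)

lemma ncmon_mult: "ncmon c u * ncmon d v = ncmon (c * d) (u @ v)"
  for c d :: "'r::comm_ring_1"
  by (simp add: ncmon_def mult_single plus_list_def)

lemma ncmon_1_Nil: "ncmon 1 [] = 1"
  by (simp add: ncmon_def flip: zero_list_def)

lemma lookup_ncmon: "Poly_Mapping.lookup (ncmon c w) v = (if v = w then c else 0)"
  by (simp add: ncmon_def lookup_single when_def)

lemma keys_ncmon: "Poly_Mapping.keys (ncmon c w) = (if c = 0 then {} else {w})"
  by (simp add: ncmon_def)

lemma ncpoly_eq_sum: "p = (\<Sum>w\<in>Poly_Mapping.keys p. ncmon (Poly_Mapping.lookup p w) w)"
proof (rule poly_mapping_eqI)
  fix w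
  show "Poly_Mapping.lookup p w
    = Poly_Mapping.lookup (\<Sum>w\<in>Poly_Mapping.keys p. ncmon (Poly_Mapping.lookup p w) w) w"
    by (auto simp: lookup_sum lookup_ncmon in_keys_iff)
qed

lemma monomial_mult_eq_sum:
  fixes g :: "('a, 'r::comm_ring_1) ncpoly"
  shows "ncmon c u * g * ncmon 1 v =
    (\<Sum>x\<in>Poly_Mapping.keys g. ncmon (c * Poly_Mapping.lookup g x) (u @ x @ v))"
  using arg_cong[OF ncpoly_eq_sum[of g], of "\<lambda>g. ncmon c u * g * ncmon 1 v"]
  by (rule trans) (simp add: sum_distrib_left sum_distrib_right ncmon_mult)

text \<open>Bridges the explicit product of the ideal definition and the ring product, so that ring
  laws apply from here on.\<close>

lemma nmul_eq_times: "nmul p p' = p * p'"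
proof -
  have "p * p' = (\<Sum>u\<in>Poly_Mapping.keys p. ncmon (Poly_Mapping.lookup p u) u) *
     (\<Sum>v\<in>Poly_Mapping.keys p'. ncmon (Poly_Mapping.lookup p' v) v)"
    using ncpoly_eq_sum[of p] ncpoly_eq_sum[of p'] by metis
  also have "\<dots> = nmul p p'"
    by (simp add: nmul_def sum_product ncmon_mult)
  finally show ?thesis by simp
qed

definition var :: "'a \<Rightarrow> ('a, 'r::comm_ring_1) ncpoly" where
  "var s = ncmon 1 [s]"

lemma var_mult: "var r * var s = ncmon 1 [r, s]"
  by (simp add: var_def ncmon_mult)

lemma ncmon_snoc: "ncmon c (w @ [s]) = ncmon c w * var s"
  by (simp add: var_def ncmon_mult)

lemma scalar_commute: "ncmon c [] * p = p * ncmon c []"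
  for c :: "'r::comm_ring_1"
proof -
  have "ncmon c [] * p = (\<Sum>w\<in>Poly_Mapping.keys p. ncmon c [] * ncmon (Poly_Mapping.lookup p w) w)"
    using arg_cong[OF ncpoly_eq_sum[of p], of "\<lambda>f. ncmon c [] * f"]
    by (rule trans) (rule sum_distrib_left)
  also have "\<dots> = (\<Sum>w\<in>Poly_Mapping.keys p. ncmon (Poly_Mapping.lookup p w) w * ncmon c [])"
    by (simp add: ncmon_mult mult.commute)
  also have "\<dots> = p * ncmon c []"
    using arg_cong[OF ncpoly_eq_sum[of p], of "\<lambda>f. f * ncmon c []"]
    by (rule sym[OF trans]) (rule sum_distrib_right)
  finally show ?thesis .
qed

text \<open>The value 1 on the empty list is a default: \<open>tau_minus\<close> vanishes on the
  empty set, so comparisons of the two ask for nonempty lists.\<close>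

fun diff_prod :: "'a list \<Rightarrow> ('a, 'r::comm_ring_1) ncpoly" where
  "diff_prod (x # y # zs) = (var y - var x) * diff_prod (y # zs)"
| "diff_prod _ = 1"

text \<open>Neighbouring differences overlap in one letter, so the cut letter \<open>a\<close>
  belongs to both factors.\<close>

lemma diff_prod_append: "diff_prod (xs @ a # ys) = diff_prod (xs @ [a]) * diff_prod (a # ys)"
proof (induction xs rule: induct_list012)
  case (3 x y zs)
  then show ?case by (simp add: mult.assoc)
qed auto

text \<open>Ideals of the free algebra on \<open>S\<close>, embedded in the free algebra on the whole type, that contain
  the relations of the Clifford algebra of the quadratic form \<open>q (\<Sum>\<^sub>s a\<^sub>s)\<^sup>2\<close>.\<close>

locale clifford_ideal =
  fixes S :: "'a::linorder set" and q :: "'r::comm_ring_1" and K :: "('a, 'r) ncpoly set"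
  assumes zero_mem: "0 \<in> K"
    and add_mem: "f \<in> K \<Longrightarrow> g \<in> K \<Longrightarrow> f + g \<in> K"
    and monomial_mult_mem:
      "f \<in> K \<Longrightarrow> set u \<subseteq> S \<Longrightarrow> set v \<subseteq> S \<Longrightarrow> ncmon c u * f * ncmon 1 v \<in> K"
    and square_mem: "s \<in> S \<Longrightarrow> var s * var s - ncmon q [] \<in> K"
    and anticomm_mem:
      "r \<in> S \<Longrightarrow> s \<in> S \<Longrightarrow> s < r \<Longrightarrow> var r * var s + var s * var r - ncmon (2 * q) [] \<in> K"
begin

lemma scalar_mult_mem: "f \<in> K \<Longrightarrow> ncmon c [] * f \<in> K"
  using monomial_mult_mem[of f "[]" "[]" c] by (simp add: ncmon_1_Nil)

lemma uminus_mem: "f \<in> K \<Longrightarrow> - f \<in> K"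
  using scalar_mult_mem[of f "- 1"] by (simp add: ncmon_uminus ncmon_1_Nil)

lemma diff_mem: "f \<in> K \<Longrightarrow> g \<in> K \<Longrightarrow> f - g \<in> K"
  using add_mem[of f "- g"] uminus_mem[of g] by simp

lemma mult_var_left_mem: "f \<in> K \<Longrightarrow> s \<in> S \<Longrightarrow> var s * f \<in> K"
  using monomial_mult_mem[of f "[s]" "[]" 1] by (simp add: var_def ncmon_1_Nil)

lemma mult_var_right_mem: "f \<in> K \<Longrightarrow> s \<in> S \<Longrightarrow> f * var s \<in> K"
  using monomial_mult_mem[of f "[]" "[s]" 1] by (simp add: var_def ncmon_1_Nil)

lemma mult_diff_left_mem: "f \<in> K \<Longrightarrow> r \<in> S \<Longrightarrow> s \<in> S \<Longrightarrow> (var r - var s) * f \<in> K"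
  by (simp add: left_diff_distrib diff_mem mult_var_left_mem)

lemma mult_diff_right_mem: "f \<in> K \<Longrightarrow> r \<in> S \<Longrightarrow> s \<in> S \<Longrightarrow> f * (var r - var s) \<in> K"
  by (simp add: right_diff_distrib diff_mem mult_var_right_mem)

lemma mult_diff_prod_left_mem: "f \<in> K \<Longrightarrow> set xs \<subseteq> S \<Longrightarrow> diff_prod xs * f \<in> K"
  by (induction xs rule: induct_list012) (auto simp: mult.assoc mult_diff_left_mem)

lemma mult_diff_prod_right_mem: "f \<in> K \<Longrightarrow> set xs \<subseteq> S \<Longrightarrow> f * diff_prod xs \<in> K"
  by (induction xs arbitrary: f rule: induct_list012)
    (auto simp: mult_diff_right_mem simp flip: mult.assoc)

lemma sign_mult_mem: "f \<in> K \<Longrightarrow> (- 1) ^ n * f \<in> K"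
  by (cases "even n") (auto simp: uminus_mem)

text \<open>The generators cover only one order of the two letters. The other order is symmetric,
  and equal letters give twice the square relation.\<close>

lemma anticomm_mem':
  assumes "r \<in> S" "s \<in> S"
  shows "var r * var s + var s * var r - ncmon (2 * q) [] \<in> K"
proof (cases r s rule: linorder_cases)
  case less
  then show ?thesis using anticomm_mem[of s r] assms by (simp add: add.commute)
next
  case equal
  have "(var s * var s - ncmon q []) + (var s * var s - ncmon q []) \<in> K"
    using square_mem add_mem assms by blast
  then show ?thesis unfolding equal ncmon_double by (simp add: algebra_simps)
next
  case greater
  then show ?thesis using anticomm_mem assms by simp
qed

text \<open>The four constants \<open>2 * q\<close> cancel because the coefficients of a difference
  add up to 0.\<close>

lemma diff_anticomm_mem:
  assumes "a \<in> S" "b \<in> S" "c \<in> S" "d \<in> S"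
  shows "(var a - var b) * (var c - var d) + (var c - var d) * (var a - var b) \<in> K"
proof -
  have "(var a * var c + var c * var a - ncmon (2 * q) []) - (var a * var d + var d * var a - ncmon (2 * q) [])
    - (var b * var c + var c * var b - ncmon (2 * q) []) + (var b * var d + var d * var b - ncmon (2 * q) []) \<in> K"
    using assms by (intro add_mem diff_mem anticomm_mem')
  then show ?thesis by (simp add: algebra_simps)
qed

text \<open>Anticommutation of a difference with itself would only give twice the square, and 2 need
  not be invertible in the ring; the square relations are used directly.\<close>

lemma diff_square_mem:
  assumes "a \<in> S" "b \<in> S"
  shows "(var a - var b) * (var a - var b) \<in> K"
proof -
  have "(var a * var a - ncmon q []) + (var b * var b - ncmon q [])
     - (var a * var b + var b * var a - ncmon (2 * q) []) \<in> K"
    using assms by (intro add_mem diff_mem anticomm_mem' square_mem)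
  then show ?thesis unfolding ncmon_double by (simp add: algebra_simps)
qed

text \<open>Each of the \<open>length xs - 1\<close> factors of \<open>diff_prod xs\<close>
  contributes one sign; truncated subtraction gives the right count 0 for the empty list as
  well.\<close>

lemma diff_diff_prod_commute:
  assumes "a \<in> S" "b \<in> S" "set xs \<subseteq> S"
  shows "(var a - var b) * diff_prod xs - (- 1) ^ (length xs - 1) * (diff_prod xs * (var a - var b)) \<in> K"
  using assms(3)
proof (induction xs rule: induct_list012)
  case (3 x y zs)
  define d where "d = (var a - var b :: ('a, 'r) ncpoly)"
  define e where "e = (var y - var x :: ('a, 'r) ncpoly)"
  define P where "P = (diff_prod (y # zs) :: ('a, 'r) ncpoly)"
  define \<epsilon> where "\<epsilon> = ((- 1) ^ length zs :: ('a, 'r) ncpoly)"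
  have "d * P - \<epsilon> * (P * d) \<in> K"
    using 3 by (simp add: d_def P_def \<epsilon>_def)
  then have "(d * e + e * d) * P - e * (d * P - \<epsilon> * (P * d)) \<in> K"
    using 3 assms
    by (auto simp: d_def e_def P_def intro!: diff_mem mult_diff_prod_right_mem diff_anticomm_mem
          mult_diff_left_mem)
  moreover have "e * \<epsilon> = \<epsilon> * e"
    unfolding \<epsilon>_def by (cases "even (length zs)") auto
  then have "e * (\<epsilon> * (P * d)) = \<epsilon> * (e * (P * d))"
    by (metis mult.assoc)
  ultimately have "d * (e * P) - (- \<epsilon>) * (e * P * d) \<in> K"
    by (simp add: algebra_simps)
  then show ?case by (simp add: d_def e_def P_def \<epsilon>_def)
qed (auto simp: zero_mem)

text \<open>Splitting a factor \<open>u + v\<close> of the product into \<open>u v\<close> amounts to multiplying by \<open>u\<close>, since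
  \<open>u (u + v) = u v\<close> and \<open>u\<close> commutes with the remaining factors up to sign.\<close>

lemma diff_prod_insert_mem:
  assumes "diff_prod (xs @ ys) \<in> K" "xs @ ys \<noteq> []" "set xs \<subseteq> S" "set ys \<subseteq> S" "x \<in> S"
  shows "diff_prod (xs @ x # ys) \<in> K"
proof (cases "xs = []")
  case True
  then obtain y zs where "ys = y # zs" using assms(2) by (cases ys) auto
  then show ?thesis using True assms by (auto intro: mult_diff_left_mem)
next
  case False
  then obtain xs' a where xs: "xs = xs' @ [a]" by (cases xs rule: rev_cases) auto
  show ?thesis
  proof (cases ys)
    case Nil
    have "diff_prod ((xs' @ [a]) @ [x]) = (diff_prod (xs' @ [a]) * (var x - var a) :: ('a, 'r) ncpoly)"
      using diff_prod_append[of xs' a "[x]"] by simp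
    then show ?thesis using assms Nil xs by (auto intro: mult_diff_right_mem)
  next
    case (Cons b zs)
    define L where "L = (diff_prod (xs' @ [a]) :: ('a, 'r) ncpoly)"
    define R where "R = (diff_prod (b # zs) :: ('a, 'r) ncpoly)"
    define u where "u = (var x - var a :: ('a, 'r) ncpoly)"
    define v where "v = (var b - var x :: ('a, 'r) ncpoly)"
    define \<epsilon> where "\<epsilon> = ((- 1) ^ length xs' :: ('a, 'r) ncpoly)"
    have whole: "diff_prod (xs @ x # ys) = L * u * v * R"
      using diff_prod_append[of xs' a "x # ys"]
      by (simp add: xs Cons L_def u_def v_def R_def mult.assoc)
    have "diff_prod (xs' @ a # ys) = (diff_prod (xs' @ [a]) * diff_prod (a # ys) :: ('a, 'r) ncpoly)"
      by (rule diff_prod_append)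
    then have old: "L * (u + v) * R \<in> K"
      using assms(1)
      by (simp add: xs Cons L_def u_def v_def R_def mult.assoc)
    have inS: "a \<in> S" "x \<in> S" "b \<in> S" "set zs \<subseteq> S" "set xs' \<subseteq> S"
      using assms xs Cons by auto
    have "u * L - \<epsilon> * (L * u) \<in> K"
      using diff_diff_prod_commute[of x a "xs' @ [a]"] inS by (simp add: L_def u_def \<epsilon>_def)
    then have "(u * L - \<epsilon> * (L * u)) * (u + v) * R \<in> K"
      unfolding R_def using inS
      by (intro mult_diff_prod_right_mem) (auto simp: u_def v_def intro!: mult_diff_right_mem)
    moreover have "u * (L * (u + v) * R) \<in> K"
      using old inS by (simp add: u_def mult_diff_left_mem)
    ultimately have "u * (L * (u + v) * R) - (u * L - \<epsilon> * (L * u)) * (u + v) * R \<in> K"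
      by (rule diff_mem[rotated])
    then have "\<epsilon> * (L * u * (u + v) * R) \<in> K"
      by (simp add: algebra_simps)
    then have "\<epsilon> * (\<epsilon> * (L * u * (u + v) * R)) \<in> K"
      unfolding \<epsilon>_def by (rule sign_mult_mem)
    moreover have "\<epsilon> * \<epsilon> = 1"
      by (cases "even (length xs')") (auto simp: \<epsilon>_def)
    ultimately have "L * u * (u + v) * R \<in> K"
      by (simp flip: mult.assoc)
    moreover have "L * (u * u) * R \<in> K"
      unfolding L_def R_def u_def using inS
      by (intro mult_diff_prod_right_mem mult_diff_prod_left_mem diff_square_mem) auto
    ultimately have "L * u * (u + v) * R - L * (u * u) * R \<in> K"
      by (rule diff_mem)
    then show ?thesis unfolding whole by (simp add: algebra_simps)
  qed
qed

end

section \<open>The elements \<open>\<tau>\<^sup>-\<^sub>J\<close> as products of differences\<close>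

lemma sorted_list_of_set_Un_less:
  fixes A B :: "'a::linorder set"
  assumes "finite A" "finite B" "\<And>a b. a \<in> A \<Longrightarrow> b \<in> B \<Longrightarrow> a < b"
  shows "sorted_list_of_set (A \<union> B) = sorted_list_of_set A @ sorted_list_of_set B"
proof -
  have "sorted_wrt (<) (sorted_list_of_set A @ sorted_list_of_set B)"
    using assms by (auto simp: sorted_wrt_append)
  then show ?thesis
    using sorted_list_of_set_unique[of "A \<union> B" "sorted_list_of_set A @ sorted_list_of_set B"] assms
    by (metis finite_UnI length_sorted_list_of_set set_append set_sorted_list_of_set
        distinct_card strict_sorted_iff)
qed

lemma sorted_list_of_set_insert_greatest:
  fixes m :: "'a::linorder"
  assumes "finite J" "\<And>j. j \<in> J \<Longrightarrow> j < m"
  shows "sorted_list_of_set (insert m J) = sorted_list_of_set J @ [m]"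
  using sorted_list_of_set_Un_less[of J "{m}"] assms by simp

lemma ellJ_insert_greatest:
  assumes "I \<subseteq> J" "\<And>j. j \<in> J \<Longrightarrow> j < m"
  shows "ellJ (insert m J) I = ellJ J I"
proof -
  have "{j \<in> insert m J. j \<le> i} = {j \<in> J. j \<le> i}" if "i \<in> I" for i
    using assms that by force
  then show ?thesis by (simp add: ellJ_def)
qed

text \<open>The new greatest element has position \<open>card J + 1\<close> in the larger set and
  rank \<open>card I + 1\<close> in the subset; all other positions are unchanged.\<close>

lemma ellJ_insert_greatest_both:
  assumes "finite J" "I \<subseteq> J" "\<And>j. j \<in> J \<Longrightarrow> j < m"
  shows "ellJ (insert m J) (insert m I) = ellJ J I + (card J - card I)"
proof -
  have "{j \<in> insert m J. j \<le> i} = {j \<in> J. j \<le> i}" "{j \<in> insert m I. j \<le> i} = {j \<in> I. j \<le> i}"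
    if "i \<in> I" for i
    using assms that by force+
  moreover have "{j \<in> insert m J. j \<le> m} = insert m J" "{j \<in> insert m I. j \<le> m} = insert m I"
    using assms by force+
  moreover have "m \<notin> J" "m \<notin> I" "finite I"
    using assms by (auto intro: finite_subset)
  ultimately show ?thesis using assms(1) by (simp add: ellJ_def)
qed

text \<open>The even part (\<open>b = False\<close>) is the companion needed for a recursion, since
  removing the greatest letter from \<open>I\<close> switches parity. For odd cardinality
  \<open>card I div 2\<close> is the exponent in \<open>tau_minus\<close>.\<close>

definition tau_part :: "bool \<Rightarrow> 'r::comm_ring_1 \<Rightarrow> 'a::linorder set \<Rightarrow> ('a, 'r) ncpoly" where
  "tau_part b q J = (\<Sum>I\<in>{I. I \<subseteq> J \<and> odd (card I) = b}.
     ncmon ((-1) ^ ellJ J I * (- q) ^ (card I div 2)) (sorted_list_of_set (J - I)))"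

lemma tau_minus_eq_tau_part: "tau_minus q J = tau_part True q J"
  unfolding tau_minus_def tau_part_def by (rule sum.cong) (auto elim!: oddE)

lemma tau_part_empty: "tau_part b q {} = (if b then 0 else 1)"
proof -
  have "{I. I \<subseteq> {} \<and> odd (card I) = b} = (if b then {} else {{}})"
    by auto
  then have "tau_part b q {} = (\<Sum>I\<in>(if b then {} else {{}}).
      ncmon ((-1) ^ ellJ {} I * (- q) ^ (card I div 2)) (sorted_list_of_set ({} - I)))"
    unfolding tau_part_def by (rule sum.cong) simp
  then show ?thesis by (cases b) (simp_all add: ellJ_def ncmon_1_Nil)
qed

lemma ncmon_scalar_sum:
  fixes c :: "'r::comm_ring_1"
  shows "ncmon c [] * (\<Sum>i\<in>A. ncmon (f i) (g i)) = (\<Sum>i\<in>A. ncmon (c * f i) (g i))"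
  by (simp add: sum_distrib_left ncmon_mult)

text \<open>Subsets avoiding \<open>m\<close> leave \<open>m\<close> as the last letter of the word.
  Subsets containing \<open>m\<close> correspond to subsets of \<open>J\<close> of the other parity
  with the same word, up to a sign and a power of \<open>q\<close>.\<close>

lemma tau_part_insert_greatest:
  fixes q :: "'r::comm_ring_1" and m :: "'a::linorder"
  assumes J: "finite J" "\<And>j. j \<in> J \<Longrightarrow> j < m"
  shows "tau_part b q (insert m J) = tau_part b q J * var m +
    ncmon ((- 1) ^ card J * (if b then 1 else q)) [] * tau_part (\<not> b) q J"
proof -
  define A where "A b = {I. I \<subseteq> J \<and> odd (card I) = b}" for b
  define F where "F J I = ncmon ((-1) ^ ellJ J I * (- q) ^ (card I div 2)) (sorted_list_of_set (J - I))"
    for I J :: "'a set"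
  have m: "m \<notin> J" using J by auto
  have fin: "finite (A b)" for b unfolding A_def using J by auto
  have sub: "finite I" "m \<notin> I" if "I \<subseteq> J" for I
    using that J m finite_subset by auto
  have split: "{I. I \<subseteq> insert m J \<and> odd (card I) = b} = A b \<union> insert m ` A (\<not> b)"
  proof (intro equalityI subsetI)
    fix I assume I: "I \<in> {I. I \<subseteq> insert m J \<and> odd (card I) = b}"
    show "I \<in> A b \<union> insert m ` A (\<not> b)"
    proof (cases "m \<in> I")
      case True
      then have "I = insert m (I - {m})" by auto
      moreover have "finite I" using I J finite_subset by auto
      then have "card I = Suc (card (I - {m}))" using True by (metis card.remove)
      then have "I - {m} \<in> A (\<not> b)" using I by (auto simp: A_def)
      ultimately show ?thesis by blast
    qed (use I in \<open>auto simp: A_def\<close>)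
  next
    fix I assume "I \<in> A b \<union> insert m ` A (\<not> b)"
    then show "I \<in> {I. I \<subseteq> insert m J \<and> odd (card I) = b}"
      using sub by (auto simp: A_def)
  qed
  have disj: "A b \<inter> insert m ` A (\<not> b) = {}"
    using m by (auto simp: A_def)
  have inj: "inj_on (insert m) (A (\<not> b))"
    using sub by (intro inj_onI) (metis (mono_tags, lifting) A_def insert_ident mem_Collect_eq)
  have "tau_part b q (insert m J) = (\<Sum>I\<in>A b \<union> insert m ` A (\<not> b). F (insert m J) I)"
    by (simp add: tau_part_def split F_def)
  also have "\<dots> = (\<Sum>I\<in>A b. F (insert m J) I) + (\<Sum>I\<in>A (\<not> b). F (insert m J) (insert m I))"
    using fin disj inj by (simp add: sum.union_disjoint sum.reindex)
  also have "(\<Sum>I\<in>A b. F (insert m J) I) = (\<Sum>I\<in>A b. F J I * var m)"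
  proof (rule sum.cong)
    fix I assume "I \<in> A b"
    then have I: "I \<subseteq> J" by (auto simp: A_def)
    then have "insert m J - I = insert m (J - I)" using m by auto
    then have "sorted_list_of_set (insert m J - I) = sorted_list_of_set (J - I) @ [m]"
      using sorted_list_of_set_insert_greatest[of "J - I" m] J by simp
    then show "F (insert m J) I = F J I * var m"
      using ellJ_insert_greatest[of I J m] I J by (simp add: F_def ncmon_snoc)
  qed simp
  also have "\<dots> = tau_part b q J * var m"
    by (simp add: tau_part_def A_def F_def sum_distrib_right)
  also have "(\<Sum>I\<in>A (\<not> b). F (insert m J) (insert m I)) =
      ncmon ((- 1) ^ card J * (if b then 1 else q)) [] * (\<Sum>I\<in>A (\<not> b). F J I)"
    unfolding F_def ncmon_scalar_sum
  proof (rule sum.cong)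
    fix I assume "I \<in> A (\<not> b)"
    then have I: "I \<subseteq> J" and par: "odd (card I) = (\<not> b)" by (auto simp: A_def)
    have "card I \<le> card J" using I J by (simp add: card_mono)
    then have sgn: "((- 1) ^ (card J - card I) :: 'r) = (- 1) ^ card J * (- 1) ^ card I"
      by (cases "even (card I)"; cases "even (card J)") auto
    have "insert m J - insert m I = J - I" using m sub[OF I] by auto
    moreover have "card (insert m I) = Suc (card I)" using sub[OF I] by simp
    \<comment> \<open>For \<open>b\<close> the sign is 1 and the exponent stays the same; otherwise
      the sign -1 and one extra factor \<open>- q\<close> combine to \<open>q\<close>.\<close>
    moreover have pow: "(- 1) ^ card I * (- q) ^ (Suc (card I) div 2) =
        (if b then 1 else q) * (- q) ^ (card I div 2)"
      using par by (cases b) (auto elim!: oddE)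
    have "(- 1) ^ (ellJ J I + (card J - card I)) * (- q) ^ (Suc (card I) div 2) =
        (- 1) ^ card J * (- 1) ^ ellJ J I * ((- 1) ^ card I * (- q) ^ (Suc (card I) div 2))"
      by (simp add: power_add sgn mult_ac)
    then have "(- 1) ^ (ellJ J I + (card J - card I)) * (- q) ^ (Suc (card I) div 2) =
        (- 1) ^ card J * (if b then 1 else q) * ((- 1) ^ ellJ J I * (- q) ^ (card I div 2))"
      unfolding pow by (simp only: mult_ac)
    ultimately show "ncmon ((- 1) ^ ellJ (insert m J) (insert m I) * (- q) ^ (card (insert m I) div 2))
        (sorted_list_of_set (insert m J - insert m I)) =
      ncmon ((- 1) ^ card J * (if b then 1 else q) * ((- 1) ^ ellJ J I * (- q) ^ (card I div 2)))
        (sorted_list_of_set (J - I))"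
      using ellJ_insert_greatest_both[of J I m] I J by simp
  qed simp
  also have "(\<Sum>I\<in>A (\<not> b). F J I) = tau_part (\<not> b) q J"
    by (simp add: tau_part_def A_def F_def)
  finally show ?thesis .
qed

lemma keys_tau_part: "w \<in> Poly_Mapping.keys (tau_part b q J) \<Longrightarrow> set w \<subseteq> J"
proof -
  assume "w \<in> Poly_Mapping.keys (tau_part b q J)"
  then have "w \<in> (\<Union>I\<in>{I. I \<subseteq> J \<and> odd (card I) = b}. Poly_Mapping.keys
         (ncmon ((-1) ^ ellJ J I * (- q) ^ (card I div 2)) (sorted_list_of_set (J - I))))"
    unfolding tau_part_def by (rule subsetD[OF keys_sum])
  then obtain I where "I \<subseteq> J"
      "w \<in> Poly_Mapping.keys
         (ncmon ((-1) ^ ellJ J I * (- q) ^ (card I div 2)) (sorted_list_of_set (J - I)))"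
    by blast
  then have "w = sorted_list_of_set (J - I)" by (auto simp: keys_ncmon split: if_splits)
  then show ?thesis by (cases "finite (J - I)") auto
qed

context clifford_ideal
begin

lemma sum_mem: "(\<And>i. i \<in> A \<Longrightarrow> f i \<in> K) \<Longrightarrow> (\<Sum>i\<in>A. f i) \<in> K"
  by (induction A rule: infinite_finite_induct) (auto simp: zero_mem add_mem)

lemma mult_left_mem:
  assumes "f \<in> K" "\<And>w. w \<in> Poly_Mapping.keys p \<Longrightarrow> set w \<subseteq> S"
  shows "p * f \<in> K"
proof -
  have "(\<Sum>w\<in>Poly_Mapping.keys p. ncmon (Poly_Mapping.lookup p w) w * f) \<in> K"
  proof (rule sum_mem)
    fix w assume "w \<in> Poly_Mapping.keys p"
    then show "ncmon (Poly_Mapping.lookup p w) w * f \<in> K"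
      using monomial_mult_mem[of f w "[]" "Poly_Mapping.lookup p w"] assms by (simp add: ncmon_1_Nil)
  qed
  moreover have "p * f = (\<Sum>w\<in>Poly_Mapping.keys p. ncmon (Poly_Mapping.lookup p w) w * f)"
    using arg_cong[OF ncpoly_eq_sum[of p], of "\<lambda>p. p * f"] by (rule trans) (rule sum_distrib_right)
  ultimately show ?thesis by simp
qed

text \<open>Append a greatest letter \<open>m\<close> after \<open>l\<close>. The recursion yields
  the old element times \<open>var m\<close> minus a signed even part. Modulo \<open>K\<close> that
  signed even part is the old element times \<open>var l\<close>, so exactly one more factor
  \<open>var m - var l\<close> splits off.\<close>

lemma tau_minus_diff_prod_mem:
  assumes "sorted_wrt (<) xs" "xs \<noteq> []" "set xs \<subseteq> S"
  shows "tau_minus q (set xs) - diff_prod xs \<in> K"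
  using assms
proof (induction xs rule: rev_induct)
  case (snoc m ys)
  show ?case
  proof (cases ys rule: rev_cases)
    case Nil
    then show ?thesis
      using tau_part_insert_greatest[of "{}" m True q]
      by (simp add: tau_minus_eq_tau_part tau_part_empty ncmon_1_Nil zero_mem)
  next
    case (snoc xs l)
    define J where "J = set xs"
    define T where "T b J = tau_part b q J" for b and J :: "'a set"
    define \<epsilon> where "\<epsilon> = ncmon ((- 1 :: 'r) ^ card J) ([] :: 'a list)"
    define Q where "Q = ncmon q ([] :: 'a list)"
    have l: "\<And>j. j \<in> J \<Longrightarrow> j < l" and m: "\<And>j. j \<in> insert l J \<Longrightarrow> j < m" "l \<notin> J"
      and inS: "J \<subseteq> S" "l \<in> S" "m \<in> S"
      using snoc.prems snoc by (auto simp: sorted_wrt_append J_def)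
    have fin: "finite J" by (simp add: J_def)
    have \<epsilon>2: "\<epsilon> * \<epsilon> = 1"
      by (cases "even (card J)") (auto simp: \<epsilon>_def ncmon_mult ncmon_1_Nil)
    have TTrue: "T True (insert l J) = T True J * var l + \<epsilon> * T False J"
      using tau_part_insert_greatest[of J l True q] l fin by (simp add: T_def \<epsilon>_def)
    have TFalse: "T False (insert l J) = T False J * var l + \<epsilon> * (Q * T True J)"
      using tau_part_insert_greatest[of J l False q] l fin
      by (simp add: T_def \<epsilon>_def Q_def ncmon_mult flip: mult.assoc)
    have "T True (insert m (insert l J)) = T True (insert l J) * var m +
        ncmon ((- 1) ^ Suc (card J)) [] * T False (insert l J)"
      using tau_part_insert_greatest[of "insert l J" m True q] m fin by (simp add: T_def)
    then have TT: "T True (insert m (insert l J)) = T True (insert l J) * var m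
        - \<epsilon> * T False (insert l J)"
      by (simp add: \<epsilon>_def ncmon_uminus)
    \<comment> \<open>Expanding both recursions at \<open>l\<close> with
      \<open>\<epsilon> * \<epsilon> = 1\<close> cancels everything except a left multiple of the
      square relation of \<open>l\<close>.\<close>
    have "T True (insert l J) * var l - \<epsilon> * T False (insert l J)
        = T True J * (var l * var l) - \<epsilon> * \<epsilon> * (Q * T True J)"
      unfolding TTrue TFalse by (simp add: algebra_simps)
    also have "\<dots> = T True J * (var l * var l - Q)"
      unfolding \<epsilon>2 Q_def right_diff_distrib mult_1 scalar_commute[of q "T True J"] ..
    also have "\<dots> \<in> K"
      unfolding Q_def T_def using keys_tau_part inS square_mem by (intro mult_left_mem) blast+
    finally have 1: "T True (insert l J) * var l - \<epsilon> * T False (insert l J) \<in> K" .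
    have "T True (insert l J) - diff_prod (xs @ [l]) \<in> K"
      using snoc.IH snoc.prems snoc
      by (simp add: T_def tau_minus_eq_tau_part J_def sorted_wrt_append)
    then have 2: "(T True (insert l J) - diff_prod (xs @ [l])) * (var m - var l) \<in> K"
      using inS by (intro mult_diff_right_mem)
    have "diff_prod ((xs @ [l]) @ [m]) = (diff_prod (xs @ [l]) * (var m - var l) :: ('a, 'r) ncpoly)"
      using diff_prod_append[of xs l "[m]"] by simp
    moreover have "set (ys @ [m]) = insert m (insert l J)" by (auto simp: snoc J_def)
    ultimately have "tau_minus q (set (ys @ [m])) - diff_prod (ys @ [m]) =
        T True (insert m (insert l J)) - diff_prod (xs @ [l]) * (var m - var l)"
      by (simp add: T_def tau_minus_eq_tau_part snoc)
    also have "\<dots> = (T True (insert l J) * var l - \<epsilon> * T False (insert l J)) +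
        (T True (insert l J) - diff_prod (xs @ [l])) * (var m - var l)"
      unfolding TT by (simp add: algebra_simps)
    also have "\<dots> \<in> K" using 1 2 by (rule add_mem)
    finally show ?thesis .
  qed
qed simp

lemma tau_minus_mem_iff:
  assumes "finite J" "J \<noteq> {}" "J \<subseteq> S"
  shows "tau_minus q J \<in> K \<longleftrightarrow> diff_prod (sorted_list_of_set J) \<in> K"
proof -
  have "tau_minus q J - diff_prod (sorted_list_of_set J) \<in> K"
    using tau_minus_diff_prod_mem[of "sorted_list_of_set J"] assms by simp
  then show ?thesis
    using add_mem[of "tau_minus q J - diff_prod (sorted_list_of_set J)" "diff_prod (sorted_list_of_set J)"]
      diff_mem[of "tau_minus q J" "tau_minus q J - diff_prod (sorted_list_of_set J)"]
    by auto
qed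

text \<open>The missing letters are inserted one at a time into the product of differences, each at
  its place in the increasing order.\<close>

lemma tau_minus_mono_mem:
  assumes "finite J" "J0 \<noteq> {}" "J0 \<subseteq> J" "J \<subseteq> S" "tau_minus q J0 \<in> K"
  shows "tau_minus q J \<in> K"
proof -
  have fin0: "finite J0" using assms finite_subset by blast
  have "tau_minus q (J0 \<union> B) \<in> K" if "finite B" "B \<subseteq> S" "B \<inter> J0 = {}" for B
    using that
  proof (induction B rule: finite_induct)
    case (insert x B)
    let ?J = "J0 \<union> B"
    have x: "x \<notin> ?J" using insert by auto
    define xs where "xs = takeWhile (\<lambda>y. y < x) (sorted_list_of_set ?J)"
    define ys where "ys = dropWhile (\<lambda>y. y < x) (sorted_list_of_set ?J)"
    have fin: "finite ?J" using fin0 insert by simp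
    have xsys: "xs @ ys = sorted_list_of_set ?J" by (simp add: xs_def ys_def)
    have "set xs \<union> set ys = ?J" using xsys fin by (metis set_append set_sorted_list_of_set)
    have ins: "sorted_list_of_set (insert x ?J) = xs @ x # ys"
    proof -
      have srt: "sorted_wrt (<) (xs @ ys)" using xsys fin by simp
      have xs: "\<forall>y\<in>set xs. y < x" by (auto simp: xs_def dest: set_takeWhileD)
      have ys: "\<forall>y\<in>set ys. x < y"
      proof (cases ys)
        case (Cons z zs)
        then have "\<not> z < x" by (metis ys_def hd_dropWhile list.sel(1) list.distinct(1))
        moreover have "z \<in> ?J" using Cons \<open>set xs \<union> set ys = ?J\<close> by auto
        ultimately have "x < z" using x by (metis linorder_neqE)
        then show ?thesis using srt Cons by (auto simp: sorted_wrt_append)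
      qed simp
      have "sorted_wrt (<) (xs @ x # ys)" using srt xs ys by (auto simp: sorted_wrt_append intro: less_trans)
      moreover have "set (xs @ x # ys) = insert x ?J" using \<open>set xs \<union> set ys = ?J\<close> by auto
      ultimately show ?thesis
        by (metis sorted_list_of_set.idem_if_sorted_distinct strict_sorted_iff)
    qed
    have "diff_prod (sorted_list_of_set ?J) \<in> K"
      using insert tau_minus_mem_iff[of ?J] fin assms by auto
    then have "diff_prod (xs @ x # ys) \<in> K"
      using xsys insert assms \<open>set xs \<union> set ys = ?J\<close> by (intro diff_prod_insert_mem) auto
    then show ?case
      using tau_minus_mem_iff[of "insert x ?J"] ins fin insert assms by auto
  qed (use assms in simp)
  from this[of "J - J0"] have "tau_minus q (J0 \<union> (J - J0)) \<in> K" using assms by blast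
  then show ?thesis using assms by (simp add: Un_absorb1)
qed

end

section \<open>Circuits, closures and levels\<close>

text \<open>If the circuit \<open>B\<close> from the elimination axiom misses \<open>f\<close>, two
  eliminations in smaller unions repair this: \<open>D\<close> and \<open>B\<close> at some
  \<open>g\<close> outside \<open>C\<close>, keeping \<open>e\<close>, give \<open>A\<close>; then
  \<open>C\<close> and \<open>A\<close> at \<open>e\<close>, keeping \<open>f\<close>.\<close>

lemma circuit_strong_elim:
  assumes M: "matroid_circuits S M" and S: "finite S"
    and "C \<in> M" "D \<in> M" "e \<in> C \<inter> D" "f \<in> C - D"
  shows "\<exists>B\<in>M. f \<in> B \<and> B \<subseteq> (C \<union> D) - {e}"
  using assms(3-)
proof (induction "card (C \<union> D)" arbitrary: C D e f rule: less_induct)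
  case less
  have sub: "A \<subseteq> S" if "A \<in> M" for A using M that by (auto simp: matroid_circuits_def)
  have inc: "A = B" if "A \<in> M" "B \<in> M" "A \<subseteq> B" for A B
    using M that unfolding matroid_circuits_def by blast
  have finU: "finite (A \<union> B)" if "A \<in> M" "B \<in> M" for A B
    using sub that S finite_subset by (metis Un_subset_iff)
  have "\<forall>J\<in>M. \<forall>K\<in>M. \<forall>x. J \<noteq> K \<and> x \<in> J \<inter> K \<longrightarrow> (\<exists>B\<in>M. B \<subseteq> (J \<union> K) - {x})"
    using M by (simp add: matroid_circuits_def)
  moreover have "C \<noteq> D" using less.prems by auto
  ultimately obtain B where B: "B \<in> M" "B \<subseteq> (C \<union> D) - {e}"
    using less.prems(1-3) by metis
  show ?case
  proof (cases "f \<in> B")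
    case False
    have "\<not> B \<subseteq> C"
    proof
      assume "B \<subseteq> C"
      then have "B = C" using inc B less.prems by blast
      then show False using False less.prems by auto
    qed
    then obtain g where g: "g \<in> B" "g \<in> D" "g \<notin> C" using B by auto
    have "D \<union> B \<subset> C \<union> D" using False B less.prems by auto
    then have "card (D \<union> B) < card (C \<union> D)"
      using psubset_card_mono finU less.prems by metis
    then obtain A where A: "A \<in> M" "e \<in> A" "A \<subseteq> (D \<union> B) - {g}"
      using less.hyps[of D B g e] less.prems B g by blast
    have "C \<union> A \<subset> C \<union> D" using A B g by auto
    then have "card (C \<union> A) < card (C \<union> D)"
      using psubset_card_mono finU less.prems by metis
    moreover have "f \<notin> A" using A False less.prems by auto
    ultimately obtain E where "E \<in> M" "f \<in> E" "E \<subseteq> (C \<union> A) - {e}"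
      using less.hyps[of C A e f] less.prems A by blast
    then show ?thesis using A B by blast
  qed (use B in blast)
qed

definition circuit_closure :: "'a set set \<Rightarrow> 'a set \<Rightarrow> 'a set" where
  "circuit_closure M F = F \<union> {s. \<exists>C\<in>M. s \<in> C \<and> C \<subseteq> insert s F}"

lemma circuit_closure_mono: "F \<subseteq> G \<Longrightarrow> circuit_closure M F \<subseteq> circuit_closure M G"
  unfolding circuit_closure_def by blast

text \<open>This is the idempotence of the closure. An element \<open>e\<close> of \<open>C\<close>
  outside \<open>F\<close> lies on a circuit within \<open>insert e F\<close>; strong elimination of
  \<open>e\<close> leaves a circuit through \<open>c\<close> with fewer elements outside
  \<open>insert c F\<close>.\<close>

lemma circuit_closure_circuit:
  assumes M: "matroid_circuits S M" and S: "finite S"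
    and "C \<in> M" "c \<in> C" "C - {c} \<subseteq> circuit_closure M F"
  shows "c \<in> circuit_closure M F"
  using assms(3-)
proof (induction "card (C - insert c F)" arbitrary: C rule: less_induct)
  case less
  have finM: "finite A" if "A \<in> M" for A
    using M S that finite_subset by (auto simp: matroid_circuits_def)
  show ?case
  proof (cases "C \<subseteq> insert c F")
    case True
    then show ?thesis using less.prems by (auto simp: circuit_closure_def)
  next
    case False
    then obtain e where e: "e \<in> C" "e \<noteq> c" "e \<notin> F" by auto
    then have "e \<in> circuit_closure M F" using less.prems by auto
    then obtain D where D: "D \<in> M" "e \<in> D" "D \<subseteq> insert e F"
      using e by (auto simp: circuit_closure_def)
    show ?thesis
    proof (cases "c \<in> F")
      case False
      then have "c \<in> C - D" using D less.prems e by auto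
      then obtain B where B: "B \<in> M" "c \<in> B" "B \<subseteq> (C \<union> D) - {e}"
        using circuit_strong_elim[OF M S, of C D e c] D e less.prems by blast
      have "B - insert c F \<subset> C - insert c F" using B D e by auto
      then have "card (B - insert c F) < card (C - insert c F)"
        using finM less.prems by (intro psubset_card_mono) auto
      moreover have "B - {c} \<subseteq> circuit_closure M F"
        using B D less.prems unfolding circuit_closure_def by blast
      ultimately show ?thesis using less.hyps[of B] B by blast
    qed (simp add: circuit_closure_def)
  qed
qed

text \<open>Circuits are broken at their minimum because that is the letter missing from the leading
  word of \<open>tau_minus\<close>.\<close>

definition no_broken_circuit :: "'a::linorder set set \<Rightarrow> 'a set \<Rightarrow> bool" where
  "no_broken_circuit M K \<longleftrightarrow> (\<forall>C\<in>M. \<not> C - {Min C} \<subseteq> K)"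

text \<open>The closures of the upper segments of \<open>K\<close> form a flag of flats; the level of \<open>s\<close> names the
  step of this flag at which \<open>s\<close> appears, \<^const>\<open>None\<close> standing for the complement of the span of \<open>K\<close>.\<close>

definition level :: "'a::linorder set set \<Rightarrow> 'a set \<Rightarrow> 'a \<Rightarrow> 'a option" where
  "level M K s =
     (if \<exists>k\<in>K. s \<in> circuit_closure M {k'\<in>K. k \<le> k'}
      then Some (Max {k\<in>K. s \<in> circuit_closure M {k'\<in>K. k \<le> k'}}) else None)"

lemma level_SomeD:
  assumes "finite K" "level M K s = Some k"
  shows "k \<in> K" "s \<in> circuit_closure M {k'\<in>K. k \<le> k'}"
proof -
  let ?A = "{k\<in>K. s \<in> circuit_closure M {k'\<in>K. k \<le> k'}}"
  have "?A \<noteq> {}" "k = Max ?A"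
    using assms by (auto simp: level_def split: if_splits)
  then have "k \<in> ?A" using Max_in[of ?A] assms by auto
  then show "k \<in> K" "s \<in> circuit_closure M {k'\<in>K. k \<le> k'}" by auto
qed

lemma level_ge:
  assumes "finite K" "k \<in> K" "s \<in> circuit_closure M {k'\<in>K. k \<le> k'}"
  obtains l where "level M K s = Some l" "k \<le> l"
proof -
  let ?A = "{k\<in>K. s \<in> circuit_closure M {k'\<in>K. k \<le> k'}}"
  have "level M K s = Some (Max ?A)" using assms by (auto simp: level_def)
  moreover have "k \<le> Max ?A" using assms by (intro Max_ge) auto
  ultimately show ?thesis using that by blast
qed

text \<open>If \<open>k\<close> already lay in the span of the elements of \<open>K\<close> from
  some larger \<open>l\<close> on, a whole circuit, and hence a broken one, would lie in
  \<open>K\<close>.\<close>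

lemma level_self:
  assumes "finite K" "no_broken_circuit M K" "k \<in> K"
  shows "level M K k = Some k"
proof -
  obtain l where l: "level M K k = Some l" "k \<le> l"
    using level_ge[of K k k M] assms by (auto simp: circuit_closure_def)
  then have "k \<in> circuit_closure M {k'\<in>K. l \<le> k'}"
    using level_SomeD assms by metis
  moreover have "\<not> (C \<subseteq> insert k {k'\<in>K. l \<le> k'})" if "C \<in> M" for C
    using assms that unfolding no_broken_circuit_def by blast
  ultimately have "l \<le> k" by (auto simp: circuit_closure_def)
  then show ?thesis using l by simp
qed

text \<open>If \<open>s\<close> were smaller than its level \<open>k\<close>, it would be the
  minimum of a circuit whose other elements all lie in \<open>K\<close>, which is a broken circuit
  in \<open>K\<close>.\<close>

lemma level_le:
  assumes M: "matroid_circuits S M" and S: "finite S"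
    and "finite K" "no_broken_circuit M K" "level M K s = Some k"
  shows "k \<le> s"
proof (rule ccontr)
  assume neg: "\<not> k \<le> s"
  have "s \<in> circuit_closure M {k'\<in>K. k \<le> k'}" using level_SomeD assms by metis
  then obtain C where C: "C \<in> M" "s \<in> C" "C \<subseteq> insert s {k'\<in>K. k \<le> k'}"
    using neg by (auto simp: circuit_closure_def)
  have "finite C" using C M S finite_subset by (auto simp: matroid_circuits_def)
  then have "Min C = s"
  proof (rule Min_eqI)
    fix y assume "y \<in> C"
    then show "s \<le> y" using C neg by auto
  qed (use C in auto)
  then have "C - {Min C} \<subseteq> K" using C by auto
  then show False using C assms by (auto simp: no_broken_circuit_def)
qed

text \<open>If the levels on a circuit were distinct, the element of the last step of the flag would
  lie in the closure of the others, hence in an earlier step.\<close>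

lemma level_not_inj_on_circuit:
  assumes M: "matroid_circuits S M" and S: "finite S"
    and K: "finite K" and C: "C \<in> M"
  shows "\<not> inj_on (level M K) C"
proof
  assume inj: "inj_on (level M K) C"
  have card: "card C > 2" using M C by (auto simp: matroid_circuits_def)
  then have finC: "finite C" "C \<noteq> {}" by (use card in \<open>force intro: card_ge_0_finite\<close>)+
  \<comment> \<open>The element \<open>c\<close> enters the flag last: its level is
    \<open>None\<close> if that occurs on the circuit, otherwise the least level, since smaller
    levels index larger flats.\<close>
  obtain c where c: "c \<in> C"
    "\<And>d. d \<in> C \<Longrightarrow> d \<noteq> c \<Longrightarrow> \<exists>k. level M K d = Some k \<and> (\<forall>l. level M K c = Some l \<longrightarrow> l < k)"
  proof (cases "None \<in> level M K ` C")
    case True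
    then obtain c where c: "c \<in> C" "level M K c = None" by auto
    show ?thesis
    proof (rule that[OF c(1)])
      fix d assume d: "d \<in> C" "d \<noteq> c"
      then have "level M K d \<noteq> None" using inj c by (metis inj_onD)
      then show "\<exists>k. level M K d = Some k \<and> (\<forall>l. level M K c = Some l \<longrightarrow> l < k)" using c by auto
    qed
  next
    case False
    define c where "c = arg_min_on (\<lambda>d. the (level M K d)) C"
    have c: "c \<in> C" using finC by (simp add: c_def arg_min_if_finite)
    show ?thesis
    proof (rule that[OF c])
      fix d assume d: "d \<in> C" "d \<noteq> c"
      obtain k l where kl: "level M K d = Some k" "level M K c = Some l"
        using False c d by (metis image_eqI not_None_eq)
      have "k \<noteq> l" using kl inj c d by (metis inj_onD)
      moreover have "l \<le> k" using arg_min_least[OF finC d(1), of "\<lambda>d. the (level M K d)"] kl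
        by (simp add: c_def)
      ultimately show "\<exists>k. level M K d = Some k \<and> (\<forall>l. level M K c = Some l \<longrightarrow> l < k)"
        using kl by auto
    qed
  qed
  \<comment> \<open>Among the flats at which the other elements appear, the one indexed by
    \<open>Min A\<close> is the largest, so it contains all of \<open>C - {c}\<close>.\<close>
  define A where "A = (\<lambda>d. the (level M K d)) ` (C - {c})"
  have A: "finite A" "A \<noteq> {}"
  proof -
    have "card (C - {c}) > 0" using card c by simp
    then show "finite A" "A \<noteq> {}" using finC by (auto simp: A_def card_gt_0_iff)
  qed
  let ?F = "\<lambda>k. circuit_closure M {k'\<in>K. k \<le> k'}"
  have "d \<in> ?F (Min A)" if d: "d \<in> C - {c}" for d
  proof -
    obtain k where k: "level M K d = Some k" using c(2)[of d] d by auto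
    have "Min A \<le> k" using A k d by (intro Min_le) (force simp: A_def)+
    then have "?F k \<subseteq> ?F (Min A)" by (intro circuit_closure_mono) auto
    then show ?thesis using level_SomeD[OF K k] by auto
  qed
  then have "c \<in> ?F (Min A)" using circuit_closure_circuit[OF M S C c(1)] by blast
  moreover obtain d where d: "d \<in> C" "d \<noteq> c" "Min A = the (level M K d)"
    using Min_in[OF A] by (auto simp: A_def)
  moreover obtain k where k: "level M K d = Some k" "\<forall>l. level M K c = Some l \<longrightarrow> l < k"
    using c(2)[OF d(1,2)] by auto
  ultimately have "c \<in> ?F k" by simp
  moreover have "k \<in> K" using level_SomeD[OF K k(1)] by simp
  ultimately obtain l where "level M K c = Some l" "k \<le> l"
    using level_ge[OF K] by metis
  then show False using k by auto
qed

section \<open>A representation of the Clifford algebra of a flag\<close>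

text \<open>With \<open>e\<close> the image of a fixed letter and \<open>d\<^sub>k\<close> the difference of a letter of level \<open>k\<close> and
  that letter, \<open>e\<^sup>2 = q\<close> and the \<open>d\<^sub>k\<close> square to zero and anticommute with each other and
  with \<open>e\<close>. The state \<open>x\<close> stands for \<open>\<Sum>\<^sub>T (x False T + x True T e) d\<^sub>T\<close>, and a letter of level \<open>l\<close> acts as
  left multiplication by \<open>e + d\<^sub>l\<close>, where \<open>d\<close> vanishes at \<^const>\<open>None\<close>.\<close>

fun create :: "'l::linorder option \<Rightarrow> (bool \<Rightarrow> 'l set \<Rightarrow> 'r) \<Rightarrow> bool \<Rightarrow> 'l set \<Rightarrow> 'r::comm_ring_1" where
  "create None x b T = 0"
| "create (Some k) x b T =
     (if k \<in> T \<and> finite T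
      then (if b then - 1 else 1) * (- 1) ^ card {j\<in>T. j < k} * x b (T - {k}) else 0)"

definition base_mult :: "'r \<Rightarrow> (bool \<Rightarrow> 'l set \<Rightarrow> 'r) \<Rightarrow> bool \<Rightarrow> 'l set \<Rightarrow> 'r::comm_ring_1" where
  "base_mult q x b T = (if b then x False T else q * x True T)"

definition act :: "'r \<Rightarrow> 'l::linorder option \<Rightarrow> (bool \<Rightarrow> 'l set \<Rightarrow> 'r) \<Rightarrow> bool \<Rightarrow> 'l set \<Rightarrow> 'r::comm_ring_1"
  where "act q l x b T = base_mult q x b T + create l x b T"

lemma create_add: "create l (\<lambda>b T. x b T + y b T) b T = create l x b T + create l y b T"
  by (cases l) (auto simp: algebra_simps)

lemma create_base_mult: "create l (base_mult q x) b T = - base_mult q (create l x) b T"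
  by (cases l) (auto simp: base_mult_def algebra_simps)

lemma create_create_same: "create l (create l x) b T = 0"
  by (cases l) auto

text \<open>Removing \<open>l\<close> does not change the number of elements below \<open>k\<close>,
  whereas removing \<open>k\<close> lowers the number below \<open>l\<close> by one.\<close>

lemma create_anticomm_less:
  assumes "k < l"
  shows "create (Some k) (create (Some l) x) b T = - create (Some l) (create (Some k) x) b T"
proof (cases "k \<in> T \<and> l \<in> T \<and> finite T")
  case True
  have "{j \<in> T - {l}. j < k} = {j \<in> T. j < k}" using assms by auto
  moreover have "{j \<in> T. j < l} = insert k {j \<in> T - {k}. j < l}" using True assms by auto
  then have "card {j \<in> T. j < l} = Suc (card {j \<in> T - {k}. j < l})" using True by simp
  moreover have "T - {k} - {l} = T - {l} - {k}" by auto
  ultimately show ?thesis using True assms by (simp add: algebra_simps)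
qed auto

lemma create_anticomm: "create k (create l x) b T + create l (create k x) b T = 0"
proof (cases "k = l")
  case False
  show ?thesis
  proof (cases "k = None \<or> l = None")
    case True
    then show ?thesis by (cases k; cases l) auto
  next
    case False
    then obtain k' l' where kl: "k = Some k'" "l = Some l'" by auto
    with \<open>k \<noteq> l\<close> consider "k' < l'" | "l' < k'" by (metis linorder_neqE)
    then show ?thesis
      by cases (simp_all only: kl create_anticomm_less[of k' l' x b T] create_anticomm_less[of l' k' x b T]
          add.right_inverse add.left_inverse)
  qed
qed (simp add: create_create_same)

text \<open>The expansion of \<open>(e + d_k) (e + d_l)\<close>: the mixed terms have opposite
  signs, so they cancel for \<open>k = l\<close> and also after symmetrising.\<close>

lemma act_act: "act q k (act q l x) b T =
    q * x b T + base_mult q (create l x) b T - base_mult q (create k x) b T + create k (create l x) b T"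
proof -
  have "act q l x = (\<lambda>b T. base_mult q x b T + create l x b T)"
    by (simp add: act_def fun_eq_iff)
  then have "create k (act q l x) b T = create k (base_mult q x) b T + create k (create l x) b T"
    by (simp only: create_add)
  moreover have "base_mult q (act q l x) b T = q * x b T + base_mult q (create l x) b T"
    by (simp add: base_mult_def act_def algebra_simps)
  moreover have "create k (base_mult q x) b T = - base_mult q (create k x) b T"
    by (rule create_base_mult)
  ultimately show ?thesis by (simp add: act_def)
qed

lemma act_square: "act q l (act q l x) b T = q * x b T"
  by (simp add: act_act create_create_same)

lemma act_anticomm: "act q k (act q l x) b T + act q l (act q k x) b T = 2 * q * x b T"
proof -
  have "act q k (act q l x) b T + act q l (act q k x) b T =
      2 * q * x b T + (create k (create l x) b T + create l (create k x) b T)"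
    by (simp add: act_act)
  then show ?thesis by (simp add: create_anticomm)
qed

section \<open>Linearity and the extension of the action to polynomials\<close>

lemma act_sum:
  "act q l (\<lambda>b T. \<Sum>i\<in>A. c i * y i b T) b T = (\<Sum>i\<in>A. c i * act q l (y i) b T)"
  by (cases l) (auto simp: act_def base_mult_def sum_distrib_left algebra_simps sum.distrib)

primrec act_word :: "'r \<Rightarrow> ('a \<Rightarrow> 'l::linorder option) \<Rightarrow> 'a list \<Rightarrow> (bool \<Rightarrow> 'l set \<Rightarrow> 'r) \<Rightarrow>
    bool \<Rightarrow> 'l set \<Rightarrow> 'r::comm_ring_1" where
  "act_word q lev [] x = x"
| "act_word q lev (s # w) x = act q (lev s) (act_word q lev w x)"

lemma act_word_append [simp]: "act_word q lev (u @ v) x = act_word q lev u (act_word q lev v x)"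
  by (induction u) auto

lemma act_word_sum:
  "act_word q lev w (\<lambda>b T. \<Sum>i\<in>A. c i * y i b T) = (\<lambda>b T. \<Sum>i\<in>A. c i * act_word q lev w (y i) b T)"
proof (induction w)
  case (Cons s w)
  show ?case by (intro ext) (simp add: Cons act_sum)
qed simp

definition act_poly :: "'r \<Rightarrow> ('a \<Rightarrow> 'l::linorder option) \<Rightarrow> ('a, 'r) ncpoly \<Rightarrow> (bool \<Rightarrow> 'l set \<Rightarrow> 'r) \<Rightarrow>
    bool \<Rightarrow> 'l set \<Rightarrow> 'r::comm_ring_1" where
  "act_poly q lev f x b T =
     (\<Sum>w\<in>Poly_Mapping.keys f. Poly_Mapping.lookup f w * act_word q lev w x b T)"

lemma act_poly_0 [simp]: "act_poly q lev 0 x b T = 0"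
  by (simp add: act_poly_def)

lemma act_poly_ncmon [simp]: "act_poly q lev (ncmon c w) x b T = c * act_word q lev w x b T"
  by (simp add: act_poly_def keys_ncmon lookup_ncmon)

lemma act_poly_add [simp]:
  "act_poly q lev (f + g) x b T = act_poly q lev f x b T + act_poly q lev g x b T"
  unfolding act_poly_def
  by (rule setsum_keys_plus_distrib[where f = "\<lambda>w c. c * act_word q lev w x b T"])
    (simp_all add: algebra_simps)

lemma act_poly_diff [simp]:
  "act_poly q lev (f - g) x b T = act_poly q lev f x b T - act_poly q lev g x b T"
  using act_poly_add[of q lev "f - g" g x b T] by simp

lemma act_poly_sum:
  "act_poly q lev (\<Sum>i\<in>A. f i) x b T = (\<Sum>i\<in>A. act_poly q lev (f i) x b T)"
  by (induction A rule: infinite_finite_induct) auto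

lemma act_poly_monomial_mult:
  "act_poly q lev (ncmon c u * f * ncmon 1 v) x b T =
     c * act_word q lev u (act_poly q lev f (act_word q lev v x)) b T"
proof -
  have "act_poly q lev (ncmon c u * f * ncmon 1 v) x b T =
      (\<Sum>w\<in>Poly_Mapping.keys f. c * Poly_Mapping.lookup f w *
         act_word q lev u (act_word q lev w (act_word q lev v x)) b T)"
    by (simp add: monomial_mult_eq_sum act_poly_sum)
  also have "\<dots> = c * act_word q lev u (act_poly q lev f (act_word q lev v x)) b T"
    by (simp add: act_poly_def[abs_def] act_word_sum sum_distrib_left mult.assoc)
  finally show ?thesis .
qed

section \<open>The kernel of the action\<close>

definition annihilator :: "'r \<Rightarrow> ('a \<Rightarrow> 'l::linorder option) \<Rightarrow> ('a, 'r::comm_ring_1) ncpoly set" where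
  "annihilator q lev = {f. \<forall>x b T. act_poly q lev f x b T = 0}"

lemma act_word_0: "act_word q lev w (\<lambda>b T. 0) = (\<lambda>b T. 0)"
  using act_word_sum[of q lev w "\<lambda>_. 0" "\<lambda>_ _ _. 0" "{}"] by simp

lemma clifford_ideal_annihilator: "clifford_ideal S q (annihilator q lev)"
proof
  fix f u v c
  assume "f \<in> annihilator q lev"
  then have "act_poly q lev f x = (\<lambda>b T. 0)" for x
    by (simp add: annihilator_def fun_eq_iff)
  then show "ncmon c u * f * ncmon 1 v \<in> annihilator q lev"
    by (simp add: annihilator_def act_poly_monomial_mult act_word_0)
next
  fix r s
  show "var r * var s + var s * var r - ncmon (2 * q) [] \<in> annihilator q lev"
    by (simp add: annihilator_def var_mult act_anticomm)
qed (simp_all add: annihilator_def var_mult act_square)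

text \<open>Two letters \<open>x < y\<close> of equal level act in the same way, so
  \<open>var y - var x\<close>, the product of differences of \<open>{x, y}\<close>, acts as zero;
  monotonicity extends this to all of \<open>C\<close>.\<close>

lemma tau_minus_annihilator:
  fixes C :: "'a::linorder set"
  assumes "\<not> inj_on lev C" "finite C"
  shows "tau_minus q C \<in> annihilator q lev"
proof -
  interpret clifford_ideal C q "annihilator q lev" by (rule clifford_ideal_annihilator)
  obtain x y where xy: "x \<in> C" "y \<in> C" "x < y" "lev x = lev y"
    using assms unfolding inj_on_def by (metis linorder_neqE)
  have "var y - var x \<in> annihilator q lev"
    by (simp add: annihilator_def var_def xy)
  moreover have "sorted_list_of_set {x, y} = [x, y]" using xy by (auto simp: insort_is_Cons)
  ultimately have "tau_minus q {x, y} \<in> annihilator q lev"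
    using xy by (subst tau_minus_mem_iff) auto
  then show ?thesis using xy assms by (intro tau_minus_mono_mem[of C "{x, y}"]) auto
qed

lemma Iq_subset_annihilator:
  assumes "finite S" "N \<subseteq> Pow S" "\<And>C. C \<in> N \<Longrightarrow> \<not> inj_on lev C"
  shows "Iq S q N \<subseteq> annihilator q lev"
proof
  interpret clifford_ideal S q "annihilator q lev" by (rule clifford_ideal_annihilator)
  fix f assume "f \<in> Iq S q N"
  then show "f \<in> annihilator q lev"
    unfolding Iq_def
  proof (induction rule: ideal_gen.induct)
    case (gen g)
    have "tau_minus q J \<in> annihilator q lev" if "J \<in> N" for J
      using that assms by (intro tau_minus_annihilator) (auto intro: finite_subset)
    then show ?case
      using gen square_mem anticomm_mem by (auto simp: Gq_def var_mult)
  next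
    case (mult p u v c)
    then show ?case using monomial_mult_mem by (simp add: nmul_eq_times mult.assoc)
  qed (auto intro: zero_mem add_mem)
qed

section \<open>Components of words applied to the unit element\<close>

definition vacuum :: "bool \<Rightarrow> 'l set \<Rightarrow> 'r::comm_ring_1" where
  "vacuum b T = (if \<not> b \<and> T = {} then 1 else 0)"

text \<open>A letter can enlarge the index set \<open>T\<close> only by its own level.\<close>

lemma act_word_vacuum_support:
  "act_word q lev w vacuum b T \<noteq> 0 \<Longrightarrow> Some ` T \<subseteq> lev ` set w"
proof (induction w arbitrary: b T)
  case (Cons s w)
  let ?x = "act_word q lev w vacuum"
  have "base_mult q ?x b T \<noteq> 0 \<or> create (lev s) ?x b T \<noteq> 0"
    using Cons.prems by (auto simp: act_def)
  then show ?case
  proof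
    assume "base_mult q ?x b T \<noteq> 0"
    then have "?x (\<not> b) T \<noteq> 0" by (auto simp: base_mult_def split: if_splits)
    then show ?thesis using Cons.IH by auto
  next
    assume *: "create (lev s) ?x b T \<noteq> 0"
    then obtain k where k: "lev s = Some k" by (cases "lev s") auto
    with * have "?x b (T - {k}) \<noteq> 0" by (auto split: if_splits)
    then have "Some ` (T - {k}) \<subseteq> lev ` set w" using Cons.IH by auto
    then show ?thesis using k by auto
  qed
qed (auto simp: vacuum_def split: if_splits)

text \<open>The prepended letter is smaller than all others, so its creation sign is 1. Its other
  summand vanishes because its level does not occur in the rest of the word.\<close>

lemma act_word_vacuum_sorted:
  assumes "sorted_wrt (<) w" "\<And>k. k \<in> set w \<Longrightarrow> lev k = Some k"
  shows "act_word q lev w vacuum False (set w) = 1"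
  using assms
proof (induction w)
  case (Cons s w)
  let ?x = "act_word q lev w vacuum"
  have "\<not> Some ` set (s # w) \<subseteq> lev ` set w"
    using Cons.prems by auto
  then have "?x True (set (s # w)) = 0"
    using act_word_vacuum_support by blast
  moreover have "{j \<in> set (s # w). j < s} = {}" "set (s # w) - {s} = set w"
    using Cons.prems by auto
  then have "create (Some s) ?x False (set (s # w)) = ?x False (set w)"
    by (simp only: create.simps) simp
  ultimately show ?case using Cons by (simp add: act_def base_mult_def del: create.simps)
qed (simp add: vacuum_def)

text \<open>A word of length at most \<open>card K\<close> whose action on the vacuum has a component at \<open>K\<close> is a
  transversal of the levels; its letters dominate the corresponding elements of \<open>K\<close>, so it is not
  below the increasing word of \<open>K\<close>.\<close>

lemma act_word_vacuum_deglex_less: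
  fixes K :: "'a::linorder set"
  assumes K: "finite K" and self: "\<And>k. k \<in> K \<Longrightarrow> lev k = Some k"
    and le: "\<And>s k. lev s = Some k \<Longrightarrow> k \<le> s"
    and less: "deglex_less w (sorted_list_of_set K)"
  shows "act_word q lev w vacuum False K = 0"
proof (rule ccontr)
  assume "act_word q lev w vacuum False K \<noteq> 0"
  then have sub: "Some ` K \<subseteq> lev ` set w" by (rule act_word_vacuum_support)
  have "card K = card (Some ` K)" by (simp add: card_image)
  also have "\<dots> \<le> card (lev ` set w)" using sub by (intro card_mono) auto
  finally have 1: "card K \<le> card (lev ` set w)" .
  have 2: "card (lev ` set w) \<le> card (set w)" by (rule card_image_le) simp
  have 3: "card (set w) \<le> length w" by (rule card_length)
  with 1 2 less obtain h where len: "length w = card K" and h: "h < length w"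
    and take: "take h w = take h (sorted_list_of_set K)" and nth: "w ! h < sorted_list_of_set K ! h"
    using K by (auto simp: deglex_less_def)
  \<comment> \<open>The numbers of elements of \<open>K\<close>, of levels, of letters and of
    positions now all agree, so \<open>lev\<close> is injective on the letters.\<close>
  have dist: "distinct w" using 1 2 3 len card_distinct by force
  have inj: "inj_on lev (set w)" using 1 2 3 len by (intro eq_card_imp_inj_on) auto
  have "Some ` K = lev ` set w"
    using sub 2 3 len K by (intro card_seteq) (auto simp: card_image)
  \<comment> \<open>At the first difference \<open>h\<close> the level \<open>k\<close> is at most
    the letter, hence below the entry of \<open>K\<close> there. So \<open>k\<close> stands earlier
    in the common prefix, and one level would occur twice.\<close>
  then obtain k where k: "k \<in> K" "lev (w ! h) = Some k"
    using h by (metis imageE image_eqI nth_mem)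
  then have "k < sorted_list_of_set K ! h" using le nth by force
  moreover obtain j where j: "j < card K" "sorted_list_of_set K ! j = k"
    using k K by (metis in_set_conv_nth length_sorted_list_of_set set_sorted_list_of_set)
  ultimately have "j < h"
    using K len h sorted_nth_mono[OF sorted_sorted_list_of_set, of h j K]
    by (metis leD length_sorted_list_of_set not_less)
  then have "w ! j = k" using take j by (metis nth_take)
  then have "lev (w ! j) = lev (w ! h)" using k self by simp
  then have "w ! j = w ! h" using inj h \<open>j < h\<close> by (auto dest: inj_onD)
  then show False using dist h \<open>j < h\<close> by (simp add: nth_eq_iff_index_eq)
qed

text \<open>Applying \<open>f\<close> to \<open>vacuum\<close> and reading the component at
  \<open>K\<close> isolates the coefficient of the word of \<open>K\<close>; no division is
  involved, so any commutative ring will do.\<close>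

lemma no_broken_circuit_not_leading:
  fixes S :: "'a::linorder set" and q :: "'r::comm_ring_1"
  assumes M: "matroid_circuits S M" and S: "finite S" and K: "finite K" "no_broken_circuit M K"
    and f: "f \<in> Iq S q M" and lead: "sorted_list_of_set K \<in> Poly_Mapping.keys f"
    and less: "\<And>v. v \<in> Poly_Mapping.keys f \<Longrightarrow> v \<noteq> sorted_list_of_set K \<Longrightarrow>
      deglex_less v (sorted_list_of_set K)"
  shows False
proof -
  let ?w = "sorted_list_of_set K"
  have self: "level M K k = Some k" if "k \<in> K" for k using level_self K that by blast
  have "f \<in> annihilator q (level M K)"
    using Iq_subset_annihilator[OF S, of M "level M K" q] level_not_inj_on_circuit[OF M S K(1)] f M
    by (auto simp: matroid_circuits_def)
  then have "0 = act_poly q (level M K) f vacuum False K" by (simp add: annihilator_def)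
  also have "\<dots> = (\<Sum>v\<in>{?w}. Poly_Mapping.lookup f v * act_word q (level M K) v vacuum False K)"
    unfolding act_poly_def
  proof (rule sum.mono_neutral_right)
    have "act_word q (level M K) v vacuum False K = 0" if "v \<in> Poly_Mapping.keys f - {?w}" for v
      using that by (intro act_word_vacuum_deglex_less[OF K(1) self level_le[OF M S K]] less) auto
    then show "\<forall>v\<in>Poly_Mapping.keys f - {?w}.
        Poly_Mapping.lookup f v * act_word q (level M K) v vacuum False K = 0"
      by simp
  qed (use lead in auto)
  also have "\<dots> = Poly_Mapping.lookup f ?w"
    using act_word_vacuum_sorted[of ?w "level M K" q] self K by simp
  finally show False using lead by (simp add: in_keys_iff)
qed

section \<open>Leading words and division\<close>

text \<open>Makes transitivity and totality available from \<open>lenlex\<close>.\<close>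

lemma deglex_less_iff_lenlex: "deglex_less u v \<longleftrightarrow> (u, v) \<in> lenlex {(x, y). x < y}"
proof -
  have "(\<exists>h<length u. take h u = take h v \<and> u ! h < v ! h) \<longleftrightarrow> (u, v) \<in> lex {(x, y). x < y}"
    if len: "length u = length v"
  proof
    assume "\<exists>h<length u. take h u = take h v \<and> u ! h < v ! h"
    then obtain h where h: "h < length u" "take h u = take h v" "u ! h < v ! h" by auto
    then have "u = take h u @ u ! h # drop (Suc h) u" "v = take h u @ v ! h # drop (Suc h) v"
      using len by (metis id_take_nth_drop)+
    then show "(u, v) \<in> lex {(x, y). x < y}"
      using h len by (auto simp: lex_conv)
  next
    assume "(u, v) \<in> lex {(x, y). x < y}"
    then obtain p x y u' v' where "u = p @ x # u'" "v = p @ y # v'" "x < y"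
      by (auto simp: lex_conv)
    then show "\<exists>h<length u. take h u = take h v \<and> u ! h < v ! h"
      by (intro exI[of _ "length p"]) auto
  qed
  then show ?thesis by (auto simp: deglex_less_def lenlex_conv)
qed

lemma deglex_less_irrefl: "\<not> deglex_less u u"
  by (auto simp: deglex_less_def)

lemma deglex_less_trans: "deglex_less u v \<Longrightarrow> deglex_less v w \<Longrightarrow> deglex_less u w"
  unfolding deglex_less_iff_lenlex
  by (rule lenlex_trans) (auto intro: transI)

lemma deglex_less_total: "u \<noteq> v \<Longrightarrow> deglex_less u v \<or> deglex_less v u"
proof -
  have "total {(x :: 'a::linorder, y). x < y}" by (auto simp: total_on_def)
  then have "total (lenlex {(x :: 'a::linorder, y). x < y})" by (rule total_lenlex)
  then show "u \<noteq> v \<Longrightarrow> deglex_less u v \<or> deglex_less v u" for u v :: "'a list"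
    unfolding deglex_less_iff_lenlex by (auto simp: total_on_def)
qed

lemma deglex_less_length: "deglex_less u v \<Longrightarrow> length u \<le> length v"
  by (auto simp: deglex_less_def)

lemma deglex_less_append:
  assumes "deglex_less u v"
  shows "deglex_less (a @ u @ b) (a @ v @ b)"
proof (cases "length u < length v")
  case False
  then obtain h where h: "h < length u" "take h u = take h v" "u ! h < v ! h" "length u = length v"
    using assms by (auto simp: deglex_less_def)
  then have "take (length a + h) (a @ u @ b) = take (length a + h) (a @ v @ b)"
    "(a @ u @ b) ! (length a + h) < (a @ v @ b) ! (length a + h)"
    by (auto simp: nth_append)
  then show ?thesis using h unfolding deglex_less_def by (intro disjI2 conjI exI[of _ "length a + h"]) auto
qed (simp add: deglex_less_def)

lemma lead_mon_eqI:
  assumes "w \<in> Poly_Mapping.keys p" "\<And>v. v \<in> Poly_Mapping.keys p \<Longrightarrow> v \<noteq> w \<Longrightarrow> deglex_less v w"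
  shows "lead_mon p = w"
  unfolding lead_mon_def
proof (rule the_equality)
  fix v assume v: "v \<in> Poly_Mapping.keys p \<and> (\<forall>v'\<in>Poly_Mapping.keys p. v' \<noteq> v \<longrightarrow> deglex_less v' v)"
  show "v = w"
  proof (rule ccontr)
    assume "v \<noteq> w"
    then have "deglex_less v w" "deglex_less w v" using v assms by auto
    then show False using deglex_less_trans deglex_less_irrefl by blast
  qed
qed (use assms in auto)

lemma finite_deglex_greatest:
  assumes "finite W" "W \<noteq> {}"
  shows "\<exists>w\<in>W. \<forall>v\<in>W. v \<noteq> w \<longrightarrow> deglex_less v w"
  using assms
proof (induction W rule: finite_ne_induct)
  case (insert x W)
  from insert.IH obtain w where w: "w \<in> W" "\<forall>v\<in>W. v \<noteq> w \<longrightarrow> deglex_less v w"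
    by (rule bexE)
  show ?case
  proof (cases "deglex_less w x")
    case True
    have "deglex_less v x" if "v \<in> W" for v
      using w(2) that True deglex_less_trans[of v w x] by (cases "v = w") auto
    then show ?thesis by (intro bexI[of _ x]) auto
  next
    case False
    then have "x \<noteq> w \<longrightarrow> deglex_less x w" using deglex_less_total[of x w] by blast
    then show ?thesis using w by (intro bexI[of _ w]) auto
  qed
qed auto

lemma
  assumes "p \<noteq> 0"
  shows lead_mon_in_keys: "lead_mon p \<in> Poly_Mapping.keys p"
    and lead_mon_greatest: "v \<in> Poly_Mapping.keys p \<Longrightarrow> v \<noteq> lead_mon p \<Longrightarrow> deglex_less v (lead_mon p)"
proof -
  have "Poly_Mapping.keys p \<noteq> {}" using assms by simp
  then obtain w where w: "w \<in> Poly_Mapping.keys p"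
    "\<forall>v\<in>Poly_Mapping.keys p. v \<noteq> w \<longrightarrow> deglex_less v w"
    using finite_deglex_greatest[of "Poly_Mapping.keys p"] by auto
  then have "lead_mon p = w" by (intro lead_mon_eqI) auto
  then show "lead_mon p \<in> Poly_Mapping.keys p"
    "v \<in> Poly_Mapping.keys p \<Longrightarrow> v \<noteq> lead_mon p \<Longrightarrow> deglex_less v (lead_mon p)"
    using w by auto
qed

section \<open>Leading words of the generators\<close>

lemma lead_mon_square:
  fixes q :: "'r::comm_ring_1"
  shows "lead_mon (ncmon 1 [s, s] - ncmon q []) = [s, s]"
    and "Poly_Mapping.lookup (ncmon 1 [s, s] - ncmon q []) [s, s] = 1"
  by (auto intro!: lead_mon_eqI simp: in_keys_iff lookup_minus lookup_ncmon deglex_less_def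
      split: if_splits)

lemma lead_mon_anticomm:
  fixes q :: "'r::comm_ring_1"
  assumes "s < r"
  shows "lead_mon (ncmon 1 [r, s] + ncmon 1 [s, r] - ncmon (2 * q) []) = [r, s]"
    and "Poly_Mapping.lookup (ncmon 1 [r, s] + ncmon 1 [s, r] - ncmon (2 * q) []) [r, s] = 1"
  using assms
  by (auto intro!: lead_mon_eqI exI[of _ 0] simp: in_keys_iff lookup_minus lookup_add lookup_ncmon
      deglex_less_def split: if_splits)

text \<open>A singleton \<open>I\<close> other than \<open>{Min J}\<close> leaves a word of equal
  length that still begins with \<open>Min J\<close>. Any other odd \<open>I\<close> has at least
  three elements and leaves a shorter word.\<close>

lemma sorted_Diff_deglex_less:
  fixes J :: "'a::linorder set"
  assumes J: "finite J" "J \<noteq> {}" and I: "I \<subseteq> J" "odd (card I)" "I \<noteq> {Min J}"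
  shows "deglex_less (sorted_list_of_set (J - I)) (sorted_list_of_set (J - {Min J}))"
proof (cases "card I = 1")
  case True
  then obtain j where j: "I = {j}" by (auto simp: card_1_singleton_iff)
  have jJ: "j \<in> J" "j \<noteq> Min J" using I j by auto
  have minJ: "Min J \<in> J" using J by simp
  have "J - {j} \<noteq> {}" "J - {Min J} \<noteq> {}" using minJ jJ by auto
  moreover have "Min (J - {j}) = Min J"
    using J minJ jJ by (intro Min_eqI) auto
  moreover have "Min (J - {Min J}) \<in> J - {Min J}"
    using J \<open>J - {Min J} \<noteq> {}\<close> by (intro Min_in) auto
  then have "Min J < Min (J - {Min J})"
    using Min_le[OF J(1)] by (metis DiffE insertI1 order.not_eq_order_implies_strict)
  moreover have "card (J - {j}) = card (J - {Min J})" using J minJ jJ by simp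
  then have "length (sorted_list_of_set (J - {j})) = length (sorted_list_of_set (J - {Min J}))"
    by (simp only: length_sorted_list_of_set)
  moreover obtain xs ys where "sorted_list_of_set (J - {j}) = Min (J - {j}) # xs"
    "sorted_list_of_set (J - {Min J}) = Min (J - {Min J}) # ys"
    using J \<open>J - {j} \<noteq> {}\<close> \<open>J - {Min J} \<noteq> {}\<close> sorted_list_of_set_nonempty finite_Diff by metis
  ultimately show ?thesis
    unfolding deglex_less_def j by (intro disjI2 conjI exI[of _ 0]) simp_all
next
  case False
  have "card I > 0" "finite I" using I J finite_subset by (auto simp: odd_pos)
  moreover have "card I \<noteq> 2" using I by auto
  ultimately have "card I > 1" using False by linarith
  moreover have "card I \<le> card J" using I J by (simp add: card_mono)
  moreover have "card (J - I) = card J - card I" using I J finite_subset by (metis card_Diff_subset)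
  ultimately have "card (J - I) < card (J - {Min J})" using J by simp
  then show ?thesis by (simp add: deglex_less_def)
qed

text \<open>The subset \<open>{Min J}\<close> contributes coefficient 1, as its \<open>ellJ\<close>
  and its exponent of \<open>- q\<close> are 0; every other subset yields a smaller word.\<close>

lemma lead_mon_tau_minus:
  fixes J :: "'a::linorder set" and q :: "'r::comm_ring_1"
  assumes J: "finite J" "J \<noteq> {}"
  shows "lead_mon (tau_minus q J) = sorted_list_of_set (J - {Min J})"
    and "Poly_Mapping.lookup (tau_minus q J) (sorted_list_of_set (J - {Min J})) = 1"
proof -
  let ?w = "sorted_list_of_set (J - {Min J})"
  let ?A = "{I. I \<subseteq> J \<and> odd (card I)}"
  let ?c = "\<lambda>I. (-1) ^ ellJ J I * (- q) ^ ((card I - 1) div 2)"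
  have lk: "Poly_Mapping.lookup (tau_minus q J) v = (\<Sum>I\<in>?A. if v = sorted_list_of_set (J - I) then ?c I else 0)" for v
    by (simp add: tau_minus_def lookup_sum lookup_ncmon cong: if_cong)
  have less: "deglex_less (sorted_list_of_set (J - I)) ?w" if "I \<in> ?A" "I \<noteq> {Min J}" for I
    using sorted_Diff_deglex_less[OF J] that by auto
  have "{j \<in> J. j \<le> Min J} = {Min J}"
    using Min_in[OF J] Min_le[OF J(1)] by (blast intro: order.antisym)
  moreover have "{i. i = Min J \<and> i \<le> Min J} = {Min J}" by auto
  ultimately have "ellJ J {Min J} = 0" by (simp add: ellJ_def)
  then have c: "?c {Min J} = 1" by simp
  have "Poly_Mapping.lookup (tau_minus q J) ?w =
      (\<Sum>I\<in>{{Min J}}. if ?w = sorted_list_of_set (J - I) then ?c I else 0)"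
    unfolding lk
  proof (rule sum.mono_neutral_right)
    show "\<forall>I\<in>?A - {{Min J}}. (if ?w = sorted_list_of_set (J - I) then ?c I else 0) = 0"
      using less deglex_less_irrefl by (metis (no_types, lifting) DiffE singletonI)
  qed (use J in auto)
  then show one: "Poly_Mapping.lookup (tau_minus q J) ?w = 1" using c by simp
  show "lead_mon (tau_minus q J) = ?w"
  proof (rule lead_mon_eqI)
    show "?w \<in> Poly_Mapping.keys (tau_minus q J)" using one by (simp add: in_keys_iff)
    fix v assume v: "v \<in> Poly_Mapping.keys (tau_minus q J)" "v \<noteq> ?w"
    have "\<exists>I\<in>?A. v = sorted_list_of_set (J - I)"
    proof (rule ccontr)
      assume "\<not> ?thesis"
      then have "Poly_Mapping.lookup (tau_minus q J) v = 0" unfolding lk by (intro sum.neutral) auto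
      then show False using v by (simp add: in_keys_iff)
    qed
    then obtain I where "I \<in> ?A" "v = sorted_list_of_set (J - I)" by (rule bexE)
    then show "deglex_less v ?w" using less v by metis
  qed
qed

text \<open>Leading coefficient 1 permits division over any commutative ring. The empty set is
  excluded because its \<open>tau_minus\<close> is 0.\<close>

lemma lead_mon_Gq_monic:
  fixes q :: "'r::comm_ring_1"
  assumes "finite S" "N \<subseteq> Pow S - {{}}" "g \<in> Gq S q N"
  shows "Poly_Mapping.lookup g (lead_mon g) = 1"
proof -
  have "Poly_Mapping.lookup (tau_minus q J) (lead_mon (tau_minus q J)) = 1" if "J \<in> N" for J
    using that assms lead_mon_tau_minus[of J q] by (metis Diff_iff PowD finite_subset insertCI subsetD)
  then show ?thesis
    using assms(3) by (auto simp: Gq_def lead_mon_square lead_mon_anticomm)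
qed

lemma ideal_gen_subset:
  assumes "G \<subseteq> ideal_gen S H"
  shows "ideal_gen S G \<subseteq> ideal_gen S H"
proof
  fix f assume "f \<in> ideal_gen S G"
  then show "f \<in> ideal_gen S H"
    by (induction rule: ideal_gen.induct) (use assms in \<open>auto intro: ideal_gen.intros\<close>)
qed

lemma clifford_ideal_Iq: "clifford_ideal S q (Iq S q N)"
proof
  show "ncmon c u * f * ncmon 1 v \<in> Iq S q N"
    if "f \<in> Iq S q N" "set u \<subseteq> S" "set v \<subseteq> S" for f u v c
    using ideal_gen.mult[of f S "Gq S q N" u v c] that by (simp add: Iq_def nmul_eq_times mult.assoc)
  show "var s * var s - ncmon q [] \<in> Iq S q N" if "s \<in> S" for s
    unfolding Iq_def var_mult by (rule ideal_gen.gen) (use that in \<open>auto simp: Gq_def\<close>)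
  show "var r * var s + var s * var r - ncmon (2 * q) [] \<in> Iq S q N" if "r \<in> S" "s \<in> S" "s < r" for r s
    unfolding Iq_def var_mult by (rule ideal_gen.gen) (use that in \<open>auto simp: Gq_def\<close>)
qed (auto simp: Iq_def intro: ideal_gen.intros)

text \<open>Polynomials may use letters of the whole type; this confines the ideal to words over the
  finite set \<open>S\<close>, on which the termination of division relies.\<close>

lemma Iq_keys_subset:
  fixes q :: "'r::comm_ring_1"
  assumes "N \<subseteq> Pow S" "f \<in> Iq S q N" "w \<in> Poly_Mapping.keys f"
  shows "set w \<subseteq> S"
  using assms(2,3) unfolding Iq_def
proof (induction arbitrary: w rule: ideal_gen.induct)
  case (gen g)
  have tau: "set w \<subseteq> S" if "w \<in> Poly_Mapping.keys (tau_minus q J)" "J \<in> N" for J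
    using keys_tau_part[of w True q J] that assms(1) by (auto simp: tau_minus_eq_tau_part)
  consider (square) s where "s \<in> S" "g = ncmon 1 [s, s] - ncmon q []"
    | (anticomm) r s where "r \<in> S" "s \<in> S" "g = ncmon 1 [r, s] + ncmon 1 [s, r] - ncmon (2 * q) []"
    | (tau) J where "J \<in> N" "g = tau_minus q J"
    using gen(1) unfolding Gq_def by blast
  then show ?case
  proof cases
    case square
    have "w = [s, s] \<or> w = []"
      using gen(2) square by (auto simp: in_keys_iff lookup_minus lookup_ncmon split: if_splits)
    then show ?thesis using square by auto
  next
    case anticomm
    have "w = [r, s] \<or> w = [s, r] \<or> w = []"
      using gen(2) anticomm
      by (auto simp: in_keys_iff lookup_add lookup_minus lookup_ncmon split: if_splits)
    then show ?thesis using anticomm by auto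
  qed (use tau gen(2) in blast)
next
  case (add p p')
  then show ?case using keys_add[of p p'] by auto
next
  case (mult p u v c)
  have "w \<in> Poly_Mapping.keys (ncmon c u * (p * ncmon 1 v))"
    using mult by (simp add: nmul_eq_times)
  then obtain a b where ab: "w = a + b" "a \<in> Poly_Mapping.keys (ncmon c u)"
    "b \<in> Poly_Mapping.keys (p * ncmon 1 v)"
    using keys_mult by blast
  then obtain x y where xy: "b = x + y" "x \<in> Poly_Mapping.keys p"
    "y \<in> Poly_Mapping.keys (ncmon 1 v :: ('a, 'r) ncpoly)"
    using keys_mult by blast
  show ?case using ab xy mult.IH[of x] mult.hyps
    by (auto simp: keys_ncmon plus_list_def split: if_splits)
qed simp

section \<open>Division by monic elements\<close>

lemma lookup_monomial_mult:
  fixes g :: "('a, 'r::comm_ring_1) ncpoly"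
  shows "Poly_Mapping.lookup (ncmon c u * g * ncmon 1 v) (u @ x @ v) = c * Poly_Mapping.lookup g x"
proof -
  have "Poly_Mapping.lookup (ncmon c u * g * ncmon 1 v) (u @ x @ v) =
      (\<Sum>y\<in>Poly_Mapping.keys g. if y = x then c * Poly_Mapping.lookup g y else 0)"
    by (auto simp: monomial_mult_eq_sum lookup_sum lookup_ncmon intro: sum.cong)
  also have "\<dots> = c * Poly_Mapping.lookup g x"
    by (auto simp: sum.delta in_keys_iff)
  finally show ?thesis .
qed

lemma keys_monomial_mult:
  fixes g :: "('a, 'r::comm_ring_1) ncpoly"
  assumes "w \<in> Poly_Mapping.keys (ncmon c u * g * ncmon 1 v)"
  obtains x where "x \<in> Poly_Mapping.keys g" "w = u @ x @ v"
proof -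
  have "w \<in> (\<Union>x\<in>Poly_Mapping.keys g.
      Poly_Mapping.keys (ncmon (c * Poly_Mapping.lookup g x) (u @ x @ v)))"
    using assms unfolding monomial_mult_eq_sum by (rule subsetD[OF keys_sum])
  then show ?thesis using that by (auto simp: keys_ncmon split: if_splits)
qed

text \<open>Subtracting a monomial multiple of a monic \<open>g\<close> cancels the leading term of
  \<open>f\<close>. This terminates because only finitely many words over \<open>S\<close> lie below
  a given one.\<close>

lemma groebner_basis_if_lead_mon_divides:
  fixes I :: "('a::linorder, 'r::comm_ring_1) ncpoly set"
  assumes S: "finite S" and G: "G \<subseteq> I" and I: "I = ideal_gen S H"
    and keys: "\<And>f w. f \<in> I \<Longrightarrow> w \<in> Poly_Mapping.keys f \<Longrightarrow> set w \<subseteq> S"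
    and monic: "\<And>g. g \<in> G \<Longrightarrow> Poly_Mapping.lookup g (lead_mon g) = 1"
    and div: "\<And>f. f \<in> I \<Longrightarrow> f \<noteq> 0 \<Longrightarrow> \<exists>g\<in>G. \<exists>u v. lead_mon f = u @ lead_mon g @ v"
  shows "I = ideal_gen S G" and "is_groebner_basis S G I"
proof -
  have sub: "ideal_gen S G \<subseteq> I" using ideal_gen_subset[of G S H] G I by simp
  have "f \<in> ideal_gen S G" if "f \<in> I" for f
    using that
  proof (induction "card {w. set w \<subseteq> S \<and> deglex_less w (lead_mon f)}" arbitrary: f rule: less_induct)
    case less
    show ?case
    proof (cases "f = 0")
      case False
      obtain g u v where g: "g \<in> G" and w: "lead_mon f = u @ lead_mon g @ v"
        using div less.prems False by blast
      let ?c = "Poly_Mapping.lookup f (lead_mon f)"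
      define h where "h = ncmon ?c u * g * ncmon 1 v"
      have lead_S: "set (lead_mon f) \<subseteq> S"
        using keys less.prems lead_mon_in_keys[OF False] by blast
      then have hG: "h \<in> ideal_gen S G"
        using ideal_gen.mult[OF ideal_gen.gen[OF g], of u S v ?c] w
        by (simp add: nmul_eq_times h_def mult.assoc)
      \<comment> \<open>Negation is obtained from the constant \<open>- 1\<close> in the
        multiplication rule of \<open>ideal_gen\<close>.\<close>
      have "ncmon (- 1) [] * h * ncmon 1 [] \<in> ideal_gen S H"
        using ideal_gen.mult[of h S H "[]" "[]" "- 1"] hG sub I
        by (auto simp: nmul_eq_times mult.assoc)
      then have "f + (- h) \<in> ideal_gen S H"
        using less.prems I by (intro ideal_gen.add) (auto simp: ncmon_uminus ncmon_1_Nil)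
      then have f': "f - h \<in> I" using I by simp
      have cancel: "Poly_Mapping.lookup (f - h) (lead_mon f) = 0"
        using monic[OF g] by (simp add: lookup_minus h_def w lookup_monomial_mult)
      have smaller: "deglex_less x (lead_mon f)" if "x \<in> Poly_Mapping.keys (f - h)" for x
      proof -
        have neq: "x \<noteq> lead_mon f" using that cancel by (auto simp: in_keys_iff)
        have "x \<in> Poly_Mapping.keys f \<or> x \<in> Poly_Mapping.keys h"
          using that by (auto simp: in_keys_iff lookup_minus)
        then show ?thesis
        proof
          assume "x \<in> Poly_Mapping.keys f"
          then show ?thesis using lead_mon_greatest[OF False] neq by blast
        next
          assume "x \<in> Poly_Mapping.keys h"
          then obtain y where y: "y \<in> Poly_Mapping.keys g" "x = u @ y @ v"
            unfolding h_def by (rule keys_monomial_mult)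
          then have "deglex_less y (lead_mon g)"
            using neq w lead_mon_greatest[of g y] by fastforce
          then show ?thesis unfolding y w by (rule deglex_less_append)
        qed
      qed
      have "f - h \<in> ideal_gen S G"
      proof (cases "f - h = 0")
        case f'0: False
        let ?B = "\<lambda>f. {w. set w \<subseteq> S \<and> deglex_less w (lead_mon f)}"
        have lead': "lead_mon (f - h) \<in> Poly_Mapping.keys (f - h)" by (rule lead_mon_in_keys[OF f'0])
        have "?B (f - h) \<subseteq> ?B f" using smaller[OF lead'] deglex_less_trans by blast
        moreover have "lead_mon (f - h) \<in> ?B f" using smaller lead' keys f' by blast
        moreover have "lead_mon (f - h) \<notin> ?B (f - h)" using deglex_less_irrefl by blast
        ultimately have "?B (f - h) \<subset> ?B f" by blast
        moreover have "finite (?B f)"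
          by (rule finite_subset[OF _ finite_lists_length_le[OF S, of "length (lead_mon f)"]])
            (auto dest: deglex_less_length)
        ultimately show ?thesis using less.hyps[OF psubset_card_mono f'] by blast
      qed (simp add: ideal_gen.zero)
      then have "(f - h) + h \<in> ideal_gen S G" using hG by (rule ideal_gen.add)
      then show ?thesis by simp
    qed (simp add: ideal_gen.zero)
  qed
  then show "I = ideal_gen S G" using sub by blast
  have "lead_term f \<in> ideal_gen S (lead_term ` G)" if f: "f \<in> I" for f
  proof (cases "f = 0")
    case False
    obtain g u v where g: "g \<in> G" and w: "lead_mon f = u @ lead_mon g @ v"
      using div f False by blast
    let ?c = "Poly_Mapping.lookup f (lead_mon f)"
    have "g \<noteq> 0" using monic[OF g] by auto
    then have "lead_term g = ncmon 1 (lead_mon g)" using monic[OF g] by (simp add: lead_term_def)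
    moreover have "set u \<subseteq> S" "set v \<subseteq> S"
      using keys[OF f lead_mon_in_keys[OF False]] w by auto
    moreover have "lead_term g \<in> ideal_gen S (lead_term ` G)" using g by (auto intro: ideal_gen.gen)
    ultimately have "ncmon ?c u * (ncmon 1 (lead_mon g) * ncmon 1 v) \<in> ideal_gen S (lead_term ` G)"
      using ideal_gen.mult[of "lead_term g" S "lead_term ` G" u v ?c] by (simp add: nmul_eq_times)
    then show ?thesis using False w by (simp add: ncmon_mult lead_term_def)
  qed (simp add: lead_term_def ideal_gen.zero)
  then have "ideal_gen S (lead_term ` I) \<subseteq> ideal_gen S (lead_term ` G)"
    by (intro ideal_gen_subset) auto
  moreover have "ideal_gen S (lead_term ` G) \<subseteq> ideal_gen S (lead_term ` I)"
    using G by (intro ideal_gen_subset) (auto intro: ideal_gen.gen)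
  ultimately show "is_groebner_basis S G I"
    using G by (auto simp: is_groebner_basis_def)
qed

section \<open>Groebner circuits\<close>

text \<open>An explicit first point of difference replaces the minimum of the symmetric difference,
  which makes transitivity elementary.\<close>

lemma dlex_less_iff:
  fixes J K :: "'a::linorder set"
  assumes "finite J" "finite K"
  shows "dlex_less J K \<longleftrightarrow> card J < card K \<or>
    card J = card K \<and> (\<exists>x\<in>J - K. \<forall>y<x. y \<in> J \<longleftrightarrow> y \<in> K)"
proof -
  let ?D = "(J - K) \<union> (K - J)"
  have fin: "finite ?D" using assms by simp
  have "J \<noteq> K \<and> Min ?D \<in> J \<longleftrightarrow> (\<exists>x\<in>J - K. \<forall>y<x. y \<in> J \<longleftrightarrow> y \<in> K)"
  proof
    assume *: "J \<noteq> K \<and> Min ?D \<in> J"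
    then have "?D \<noteq> {}" by blast
    then have "Min ?D \<in> ?D" using fin by (rule Min_in[rotated])
    moreover have "y \<in> J \<longleftrightarrow> y \<in> K" if "y < Min ?D" for y
      using Min_le[OF fin, of y] that by (auto simp: not_le[symmetric])
    ultimately show "\<exists>x\<in>J - K. \<forall>y<x. y \<in> J \<longleftrightarrow> y \<in> K" using * by blast
  next
    assume "\<exists>x\<in>J - K. \<forall>y<x. y \<in> J \<longleftrightarrow> y \<in> K"
    then obtain x where x: "x \<in> J - K" "\<forall>y<x. y \<in> J \<longleftrightarrow> y \<in> K" by blast
    have "Min ?D = x"
    proof (rule Min_eqI[OF fin])
      fix y assume "y \<in> ?D"
      then show "x \<le> y" using x(2) by (metis DiffE UnE not_le)
    qed (use x in blast)
    then show "J \<noteq> K \<and> Min ?D \<in> J" using x by auto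
  qed
  then show ?thesis by (auto simp: dlex_less_def)
qed

lemma dlex_less_trans:
  fixes J K L :: "'a::linorder set"
  assumes fin: "finite J" "finite K" "finite L" and less: "dlex_less J K" "dlex_less K L"
  shows "dlex_less J L"
proof (cases "card J < card K \<or> card K < card L")
  case True
  then have "card J < card L" using less unfolding dlex_less_def by linarith
  then show ?thesis by (simp add: dlex_less_def)
next
  case False
  then have "\<exists>x\<in>J - K. \<forall>z<x. z \<in> J \<longleftrightarrow> z \<in> K" "\<exists>y\<in>K - L. \<forall>z<y. z \<in> K \<longleftrightarrow> z \<in> L"
    and card: "card J = card L"
    using less by (simp_all add: dlex_less_iff fin)
  then obtain x y where x: "x \<in> J - K" "\<forall>z<x. z \<in> J \<longleftrightarrow> z \<in> K"
    and y: "y \<in> K - L" "\<forall>z<y. z \<in> K \<longleftrightarrow> z \<in> L"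
    by meson
  have "min x y \<in> J - L \<and> (\<forall>z<min x y. z \<in> J \<longleftrightarrow> z \<in> L)"
  proof (cases x y rule: linorder_cases)
    case less
    then show ?thesis using x y by (auto simp: min_def)
  next
    case greater
    then show ?thesis using x y by (auto simp: min_def)
  qed (use x y in auto)
  then show ?thesis using card unfolding dlex_less_iff[OF fin(1,3)] by blast
qed

lemma wf_dlex_less:
  assumes "finite S"
  shows "wf {(K, J). K \<subseteq> S \<and> J \<subseteq> S \<and> dlex_less K J}" (is "wf ?R")
proof (rule finite_acyclic_wf)
  show "finite ?R" by (rule finite_subset[of _ "Pow S \<times> Pow S"]) (use assms in auto)
  have "trans ?R"
  proof (rule transI)
    fix J K L assume "(J, K) \<in> ?R" "(K, L) \<in> ?R"
    then show "(J, L) \<in> ?R"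
      using dlex_less_trans[of J K L] assms finite_subset by auto
  qed
  then show "acyclic ?R" by (auto simp: acyclic_def trancl_id dlex_less_def)
qed

definition is_groebner_circuit_set :: "'a::linorder set \<Rightarrow> 'a set set \<Rightarrow> 'a set set \<Rightarrow> bool" where
  "is_groebner_circuit_set S M X \<longleftrightarrow> X \<subseteq> Pow S \<and>
     (\<forall>J. J \<subseteq> S \<longrightarrow> (J \<in> X \<longleftrightarrow> dependent_in M J \<and>
        (\<forall>K\<in>X. dlex_less K J \<longrightarrow> \<not> convex_sub (K - {Min K}) (J - {Min J}))))"

text \<open>Membership of \<open>J\<close> depends only on the members below \<open>J\<close>, so
  two solutions agree by well-founded induction.\<close>

lemma groebner_circuit_set_unique:
  assumes S: "finite S" and X: "is_groebner_circuit_set S M X" and Y: "is_groebner_circuit_set S M Y"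
  shows "X = Y"
proof -
  have "J \<subseteq> S \<longrightarrow> (J \<in> X \<longleftrightarrow> J \<in> Y)" for J
  proof (induction J rule: wf_induct_rule[OF wf_dlex_less[OF S]])
    case (1 J)
    show ?case
    proof
      assume J: "J \<subseteq> S"
      have "K \<in> X \<longleftrightarrow> K \<in> Y" if "dlex_less K J" "K \<in> X \<union> Y" for K
      proof -
        have "K \<subseteq> S" using that X Y by (auto simp: is_groebner_circuit_set_def)
        then show ?thesis using 1[of K] J that by blast
      qed
      then have "(\<forall>K\<in>X. dlex_less K J \<longrightarrow> \<not> convex_sub (K - {Min K}) (J - {Min J})) \<longleftrightarrow>
          (\<forall>K\<in>Y. dlex_less K J \<longrightarrow> \<not> convex_sub (K - {Min K}) (J - {Min J}))"
        by blast
      then show "J \<in> X \<longleftrightarrow> J \<in> Y" using X Y J unfolding is_groebner_circuit_set_def by simp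
    qed
  qed
  moreover have "X \<subseteq> Pow S" "Y \<subseteq> Pow S" using X Y by (auto simp: is_groebner_circuit_set_def)
  ultimately show ?thesis by blast
qed

text \<open>The family is built as a predicate by well-founded recursion along
  \<open>dlex_less\<close> on subsets of \<open>S\<close>.\<close>

lemma groebner_circuit_set_exists:
  assumes S: "finite S"
  shows "\<exists>X. is_groebner_circuit_set S M X"
proof -
  define R where "R = {(K, J). K \<subseteq> S \<and> J \<subseteq> S \<and> dlex_less K J}"
  define F where "F f J \<longleftrightarrow> dependent_in M J \<and>
     (\<forall>K. (K, J) \<in> R \<longrightarrow> f K \<longrightarrow> \<not> convex_sub (K - {Min K}) (J - {Min J}))" for f J
  define g where "g = wfrec R F"
  have wf: "wf R" unfolding R_def by (rule wf_dlex_less[OF S])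
  have "g J \<longleftrightarrow> F (cut g R J) J" for J
    unfolding g_def by (subst wfrec[OF wf]) simp
  \<comment> \<open>\<open>F\<close> queries its argument only at predecessors of \<open>J\<close>,
    where \<open>cut\<close> changes nothing.\<close>
  moreover have "F (cut g R J) J \<longleftrightarrow> F g J" for J
    by (simp add: F_def cut_apply)
  ultimately have g: "g J \<longleftrightarrow> F g J" for J
    by (rule trans)
  have "is_groebner_circuit_set S M {J. J \<subseteq> S \<and> g J}"
    unfolding is_groebner_circuit_set_def
  proof (intro conjI allI impI)
    fix J assume J: "J \<subseteq> S"
    show "J \<in> {J. J \<subseteq> S \<and> g J} \<longleftrightarrow> dependent_in M J \<and>
        (\<forall>K\<in>{J. J \<subseteq> S \<and> g J}. dlex_less K J \<longrightarrow> \<not> convex_sub (K - {Min K}) (J - {Min J}))"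
      using g[of J] J by (auto simp: F_def R_def)
  qed auto
  then show ?thesis by blast
qed

lemma is_groebner_circuit_set_groebner_circuits:
  assumes S: "finite S"
  shows "is_groebner_circuit_set S M (groebner_circuits S M)"
proof -
  have "\<exists>!X. is_groebner_circuit_set S M X"
    using groebner_circuit_set_exists[OF S] groebner_circuit_set_unique[OF S] by blast
  then show ?thesis
    unfolding groebner_circuits_def is_groebner_circuit_set_def by (rule theI')
qed

lemma groebner_circuitsD:
  assumes "finite S" "J \<in> groebner_circuits S M"
  shows "J \<subseteq> S" "dependent_in M J"
  using is_groebner_circuit_set_groebner_circuits[OF assms(1), of M] assms(2)
  unfolding is_groebner_circuit_set_def by auto

lemma convex_sub_refl: "convex_sub K K"
  by (auto simp: convex_sub_def)

lemma convex_sub_trans: "convex_sub K J \<Longrightarrow> convex_sub J L \<Longrightarrow> convex_sub K L"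
  unfolding convex_sub_def by (meson subset_trans subsetD)

text \<open>A dependent set is a Groebner circuit itself, or is rejected by the recursion because of
  a smaller one, which is the required witness.\<close>

lemma dependent_dominates_groebner_circuit:
  assumes "finite S" "J \<subseteq> S" "dependent_in M J"
  shows "\<exists>K\<in>groebner_circuits S M. convex_sub (K - {Min K}) (J - {Min J})"
proof (cases "J \<in> groebner_circuits S M")
  case True
  then show ?thesis using convex_sub_refl by blast
next
  case False
  then show ?thesis
    using is_groebner_circuit_set_groebner_circuits[OF assms(1), of M] assms(2,3)
    unfolding is_groebner_circuit_set_def by blast
qed

text \<open>A convex subset is the block of \<open>J\<close> between the elements below its minimum
  and those above its maximum.\<close>

lemma sorted_list_of_convex_sub:
  fixes J :: "'a::linorder set"
  assumes "convex_sub K J" "finite J"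
  shows "\<exists>u v. sorted_list_of_set J = u @ sorted_list_of_set K @ v"
proof (cases "K = {}")
  case False
  have fin: "finite K" "K \<subseteq> J" using assms finite_subset by (auto simp: convex_sub_def)
  have minmax: "Min K \<in> K" "Max K \<in> K" using fin False by auto
  let ?A = "{j\<in>J. j < Min K}" and ?B = "{j\<in>J. j > Max K}"
  have bounds: "Min K \<le> k" "k \<le> Max K" if "k \<in> K" for k using that fin by auto
  have conv: "j \<in> K" if "j \<in> J" "\<not> j < Min K" "\<not> Max K < j" for j
  proof (cases "j = Min K \<or> j = Max K")
    case False
    then have "Min K < j" "j < Max K" using that by auto
    then show ?thesis using assms(1) minmax that unfolding convex_sub_def by blast
  qed (use minmax in auto)
  have J: "J = ?A \<union> (K \<union> ?B)" using conv fin by blast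
  have "sorted_list_of_set (?A \<union> (K \<union> ?B)) = sorted_list_of_set ?A @ sorted_list_of_set (K \<union> ?B)"
  proof (rule sorted_list_of_set_Un_less)
    fix a b assume "a \<in> ?A" "b \<in> K \<union> ?B"
    then show "a < b" using bounds(1)[of b] bounds(2)[OF minmax(1)] by auto
  qed (use assms fin in auto)
  also have "sorted_list_of_set (K \<union> ?B) = sorted_list_of_set K @ sorted_list_of_set ?B"
  proof (rule sorted_list_of_set_Un_less)
    fix a b assume "a \<in> K" "b \<in> ?B"
    then show "a < b" using bounds(2)[of a] by auto
  qed (use assms fin in auto)
  finally show ?thesis using J by auto
qed (simp, metis append_Nil)

text \<open>Filling the gaps of a broken circuit \<open>C - {Min C} \<subseteq> K\<close> with the elements of \<open>K\<close> in its range keeps the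
  set dependent and makes it convex in \<open>K\<close>.\<close>

lemma broken_circuit_dominates_groebner_circuit:
  assumes M: "matroid_circuits S M" and S: "finite S" and K: "K \<subseteq> S" and C: "C \<in> M" "C - {Min C} \<subseteq> K"
  shows "\<exists>J\<in>groebner_circuits S M. convex_sub (J - {Min J}) K"
proof -
  have CS: "C \<subseteq> S" "card C > 2" using M C by (auto simp: matroid_circuits_def)
  have finC: "finite C" "C \<noteq> {}" using CS by (auto intro: card_ge_0_finite)
  define c where "c = Min C"
  have c: "c \<in> C" "\<And>d. d \<in> C - {c} \<Longrightarrow> c < d"
    using finC by (auto simp: c_def less_le)
  have "card (C - {c}) > 0" using CS c by simp
  then have ne: "finite (C - {c})" "C - {c} \<noteq> {}" by (auto simp: card_gt_0_iff)
  define B where "B = {k\<in>K. Min (C - {c}) \<le> k \<and> k \<le> Max (C - {c})}"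
  \<comment> \<open>Since \<open>c\<close> stays the minimum after the filling, deleting the minimum
    of \<open>insert c B\<close> leaves exactly \<open>B\<close>.\<close>
  have "c < b" if "b \<in> B" for b
    using that c(2)[OF Min_in[OF ne]] by (auto simp: B_def)
  moreover have "finite B" using finite_subset[OF K S] by (simp add: B_def)
  ultimately have min: "Min (insert c B) = c" "c \<notin> B"
    by (auto intro!: Min_eqI simp: less_imp_le)
  have "C \<subseteq> insert c B" using C ne by (auto simp: B_def c_def)
  then have "dependent_in M (insert c B)" using C by (auto simp: dependent_in_def)
  moreover have "insert c B \<subseteq> S" using c CS K by (auto simp: B_def)
  ultimately obtain J where J: "J \<in> groebner_circuits S M"
    "convex_sub (J - {Min J}) (insert c B - {Min (insert c B)})"
    using dependent_dominates_groebner_circuit[OF S] by blast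
  moreover have "convex_sub B K"
    unfolding convex_sub_def B_def by (auto intro: less_imp_le order_trans)
  ultimately show ?thesis using min convex_sub_trans by auto
qed

lemma not_sorted_adjacent:
  fixes w :: "'a::linorder list"
  assumes "\<not> sorted_wrt (<) w"
  shows "\<exists>u r s v. w = u @ [r, s] @ v \<and> s \<le> r"
  using assms
proof (induction w rule: induct_list012)
  case (3 x y zs)
  show ?case
  proof (cases "x < y")
    case True
    then have "\<not> sorted_wrt (<) (y # zs)" using "3.prems" by (auto intro: less_trans)
    then obtain u r s v where "y # zs = u @ [r, s] @ v" "s \<le> r" using "3.IH"(2) by blast
    then have "x # y # zs = (x # u) @ [r, s] @ v" by simp
    then show ?thesis using \<open>s \<le> r\<close> by blast
  next
    case False
    then have "x # y # zs = [] @ [x, y] @ zs" "y \<le> x" by auto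
    then show ?thesis by blast
  qed
qed auto

text \<open>A word that is not strictly increasing contains the leading word of a quadratic
  generator. An increasing leading word must contain a broken circuit, hence as a consecutive block
  the leading word of \<open>tau_minus\<close> for some Groebner circuit.\<close>

lemma lead_mon_Iq_divisible:
  fixes S :: "'a::linorder set" and q :: "'r::comm_ring_1"
  assumes S: "finite S" and M: "matroid_circuits S M" and f: "f \<in> Iq S q M" "f \<noteq> 0"
  shows "\<exists>g\<in>Gq S q (groebner_circuits S M). \<exists>u v. lead_mon f = u @ lead_mon g @ v"
proof -
  have MS: "M \<subseteq> Pow S" using M by (simp add: matroid_circuits_def)
  have wS: "set (lead_mon f) \<subseteq> S" using Iq_keys_subset[OF MS f(1)] lead_mon_in_keys[OF f(2)] .
  show ?thesis
  proof (cases "sorted_wrt (<) (lead_mon f)")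
    case False
    then obtain u r s v where w: "lead_mon f = u @ [r, s] @ v" and "s \<le> r"
      using not_sorted_adjacent by blast
    have rs: "r \<in> S" "s \<in> S" using w wS by auto
    show ?thesis
    proof (cases "r = s")
      case True
      have "ncmon 1 [s, s] - ncmon q [] \<in> Gq S q (groebner_circuits S M)"
        using rs by (auto simp: Gq_def)
      then show ?thesis using w True lead_mon_square(1)[of s q] by metis
    next
      case False
      then have "s < r" using \<open>s \<le> r\<close> by simp
      have "ncmon 1 [r, s] + ncmon 1 [s, r] - ncmon (2 * q) [] \<in> Gq S q (groebner_circuits S M)"
        using rs \<open>s < r\<close> by (auto simp: Gq_def)
      then show ?thesis using w lead_mon_anticomm(1)[OF \<open>s < r\<close>, of q] by metis
    qed
  next
    case True
    let ?K = "set (lead_mon f)"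
    have w: "sorted_list_of_set ?K = lead_mon f"
      using True by (metis sorted_list_of_set.idem_if_sorted_distinct strict_sorted_iff)
    have "\<not> no_broken_circuit M ?K"
      using no_broken_circuit_not_leading[OF M S _ _ f(1), of ?K] w
        lead_mon_in_keys[OF f(2)] lead_mon_greatest[OF f(2)] by auto
    then obtain C where "C \<in> M" "C - {Min C} \<subseteq> ?K" by (auto simp: no_broken_circuit_def)
    then obtain J where J: "J \<in> groebner_circuits S M" "convex_sub (J - {Min J}) ?K"
      using broken_circuit_dominates_groebner_circuit[OF M S wS] by blast
    have "finite J" "J \<noteq> {}"
    proof -
      show "finite J" using groebner_circuitsD[OF S J(1)] S finite_subset by auto
      show "J \<noteq> {}" using groebner_circuitsD[OF S J(1)] M
        by (force simp: dependent_in_def matroid_circuits_def)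
    qed
    then have "lead_mon (tau_minus q J) = sorted_list_of_set (J - {Min J})"
      by (rule lead_mon_tau_minus)
    moreover obtain u v where "sorted_list_of_set ?K = u @ sorted_list_of_set (J - {Min J}) @ v"
      using sorted_list_of_convex_sub[OF J(2)] by auto
    moreover have "tau_minus q J \<in> Gq S q (groebner_circuits S M)" using J by (auto simp: Gq_def)
    ultimately show ?thesis using w by metis
  qed
qed

text \<open>Groebner circuits are dependent, so each contains a circuit, and membership of
  \<open>tau_minus\<close> in the ideal passes to supersets.\<close>

lemma Gq_groebner_circuits_subset:
  fixes S :: "'a::linorder set" and q :: "'r::comm_ring_1"
  assumes S: "finite S" and M: "matroid_circuits S M"
  shows "Gq S q (groebner_circuits S M) \<subseteq> Iq S q M"
proof -
  interpret clifford_ideal S q "Iq S q M" by (rule clifford_ideal_Iq)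
  have "tau_minus q J \<in> Iq S q M" if gc: "J \<in> groebner_circuits S M" for J
  proof -
    obtain C where C: "C \<in> M" "C \<subseteq> J" and J: "J \<subseteq> S"
      using groebner_circuitsD[OF S gc] by (auto simp: dependent_in_def)
    have "tau_minus q C \<in> Iq S q M"
      unfolding Iq_def by (rule ideal_gen.gen) (use C in \<open>auto simp: Gq_def\<close>)
    moreover have "C \<noteq> {}" using C M by (auto simp: matroid_circuits_def)
    ultimately show ?thesis using C J S finite_subset by (intro tau_minus_mono_mem[of J C]) auto
  qed
  then show ?thesis using square_mem anticomm_mem by (auto simp: Gq_def var_mult)
qed

theorem theorem1p1:
  fixes S :: "'a::linorder set" and M :: "'a set set" and q :: "'r::comm_ring_1"
  assumes "finite S"
    and "matroid_circuits S M"
  shows "Iq S q M = Iq S q (groebner_circuits S M) \<and>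
         is_groebner_basis S (Gq S q (groebner_circuits S M)) (Iq S q M)"
proof -
  have MS: "M \<subseteq> Pow S" using assms(2) by (simp add: matroid_circuits_def)
  have "{} \<notin> groebner_circuits S M"
    using groebner_circuitsD(2)[OF assms(1), of "{}" M] assms(2)
    by (force simp: dependent_in_def matroid_circuits_def)
  then have N: "groebner_circuits S M \<subseteq> Pow S - {{}}"
    using groebner_circuitsD(1)[OF assms(1)] by blast
  have keys: "set w \<subseteq> S" if "f \<in> Iq S q M" "w \<in> Poly_Mapping.keys f" for f w
    using Iq_keys_subset[OF MS that] .
  have monic: "Poly_Mapping.lookup g (lead_mon g) = 1" if "g \<in> Gq S q (groebner_circuits S M)" for g
    using lead_mon_Gq_monic[OF assms(1) N that] .
  have div: "\<exists>g\<in>Gq S q (groebner_circuits S M). \<exists>u v. lead_mon f = u @ lead_mon g @ v"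
    if "f \<in> Iq S q M" "f \<noteq> 0" for f
    using lead_mon_Iq_divisible[OF assms that] .
  note groebner = groebner_basis_if_lead_mon_divides[OF assms(1)
      Gq_groebner_circuits_subset[OF assms] Iq_def]
  have "Iq S q M = ideal_gen S (Gq S q (groebner_circuits S M))"
    by (rule groebner(1)) (use keys monic div in blast)+
  moreover have "is_groebner_basis S (Gq S q (groebner_circuits S M)) (Iq S q M)"
    by (rule groebner(2)) (use keys monic div in blast)+
  ultimately show ?thesis by (simp add: Iq_def[of S q "groebner_circuits S M"])
qed

end
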